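(* Let $X=(V,\Sigma)$ be a simplicial complex with $V=\{1,\dots,n\}$, let ${}^0\mathcal{G}$ be a simplicial amalgam over $X$ in a concrete category $\mathbf{C}$, and let ${}^0\mathcal{A}$ be the coefficient system associated to ${}^0\mathcal{G}$. Then the isomorphism classes of amalgams of type ${}^0\mathcal{G}$ are parametrized by $H^1(X,{}^0\mathcal{A})$; that is, there is a bijection between the set of isomorphism classes of amalgams of type ${}^0\mathcal{G}$ and the set $H^1(X,{}^0\mathcal{A})$.
   Context: **Simplicial complex.** $X=(V,\Sigma)$ with $V=\{1,\dots,n\}$, $n\ge1$, and $\Sigma$ a collection of non-empty subsets of $V$ (simplices) containing all $\{v\}$, $v\in V$, and closed under taking non-empty subsets. $\Sigma_k$ is the set of simplices with $k+1$ elements. For simplices, $\sigma\le\tau$ means $\sigma\subseteq\tau$. Braces are omitted in indices: $i,ij,ijk$ stand for $\{i\},\{i,j\},\{i,j,k\}$. $\mathbf{X}$ is the poset category of $(\Sigma,\le)$. **Concrete category.** A category $\mathbf{C}$ with a faithful functor $F\colon\mathbf{C}\to\mathbf{Set}$; write $|A|=F(A)$ and identify a morphism $f$ with the function $F(f)$. A morphism $f\colon A\to B$ is an *embedding* if (1) the function $f\colon|A|\to|B|$ is injective and (2) $f$ is initial: for every object $C$, a function $g\colon|C|\to|A|$ underlies a $\mathbf{C}$-morphism $C\to A$ whenever $f\circ g\colon|C|\to|B|$ underlies a $\mathbf{C}$-morphism $C\to B$. **Simplicial amalgam over $X$ in $\mathbf{C}$**: a contravariant functor $\mathcal{G}\colon\mathbf{X}\to\mathbf{C}$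 such that for all $\sigma\le\tau$ the morphism $\varphi^\sigma_\tau\colon\mathcal{G}_\tau\to\mathcal{G}_\sigma$ (the image of $\sigma\le\tau$) is an embedding, where $\mathcal{G}_\sigma=\mathcal{G}(\sigma)$. Put $|\bar{\mathcal{G}}_{\sigma,\tau}|=\varphi^\sigma_\tau(|\mathcal{G}_\tau|)\subseteq|\mathcal{G}_\sigma|$. **Isomorphism** of amalgams: a natural isomorphism, i.e. a family of $\mathbf{C}$-isomorphisms $\phi_\sigma\colon\mathcal{G}^{(1)}_\sigma\to\mathcal{G}^{(2)}_\sigma$ with $\phi_\sigma\circ{}^{(1)}\varphi^\sigma_\tau={}^{(2)}\varphi^\sigma_\tau\circ\phi_\tau$ for all $\sigma\le\tau$. **Amalgam of type ${}^0\mathcal{G}$**: an amalgam $\mathcal{G}$ over $X$ in $\mathbf{C}$ with $\mathcal{G}_\sigma={}^0\mathcal{G}_\sigma$ for all $\sigma\in\Sigma$ and $|\bar{\mathcal{G}}_{\sigma,\tau}|=|\overline{{}^0\mathcal{G}}_{\sigma,\tau}|$ for all $\sigma\le\tau$. **Coefficient system of ${}^0\mathcal{G}=\{\mathcal{G}_\bullet,\psi^\bullet_\bullet\}$.** The functor ${}^0\mathcal{A}=\{A_\bullet,\alpha^\bullet_\bullet\}\colon\mathbf{X}\to\mathbf{Group}$ with $A_\sigma=\{g\in\mathrm{Aut}_{\mathbf{C}}(\mathcal{G}_\sigma)\mid g(|\bar{\mathcal{G}}_{\sigma,\tau}|)=|\bar{\mathcal{G}}_{\sigma,\tau}|\text{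 for all }\tau\text{ with }\sigma\le\tau\}$ and $\alpha^\sigma_\tau\colon A_\sigma\to A_\tau$, $f\mapsto(\psi^\sigma_\tau)^{-1}\circ f\circ\psi^\sigma_\tau$, where $(\psi^\sigma_\tau)^{-1}$ denotes the inverse of the bijection $|\mathcal{G}_\tau|\to|\bar{\mathcal{G}}_{\sigma,\tau}|$ (the result is a $\mathbf{C}$-automorphism because $\psi^\sigma_\tau$ is an embedding). **Cohomology.** $\mathcal{C}^i=\prod_{\sigma\in\Sigma_i}A_\sigma$. $Z^1(X,{}^0\mathcal{A})$ is the set of $(a_{ij})_{\{i,j\}\in\Sigma_1,\,i<j}\in\mathcal{C}^1$ with $\alpha^{jk}_{ijk}(a_{jk}^{-1})\,\alpha^{ik}_{ijk}(a_{ik})\,\alpha^{ij}_{ijk}(a_{ij}^{-1})=\mathrm{id}$ for all $\{i,j,k\}\in\Sigma_2$, $i<j<k$. The group $\mathcal{C}^0$ acts on the right on $\mathcal{C}^1$ by $(b_{ij})^{(a_k)}=(\alpha^j_{ij}(a_j^{-1})\,b_{ij}\,\alpha^i_{ij}(a_i))$, $i<j$; this preserves $Z^1(X,{}^0\mathcal{A})$, and $H^1(X,{}^0\mathcal{A})$ is the set of $\mathcal{C}^0$-orbits on $Z^1(X,{}^0\mathcal{A})$. *)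

theory Defs
  imports "HOL-Algebra.Group"
begin

section \<open>Concrete categories\<close>

record ('o, 'm) precategory =
  Ob :: "'o set"
  Arr :: "'m set"
  Dom :: "'m \<Rightarrow> 'o"
  Cod :: "'m \<Rightarrow> 'o"
  ident :: "'o \<Rightarrow> 'm"
  comp :: "'m \<Rightarrow> 'm \<Rightarrow> 'm" (infixl "\<cdot>\<index>" 70)

definition arrows :: "('o, 'm, 'z) precategory_scheme \<Rightarrow> 'o \<Rightarrow> 'o \<Rightarrow> 'm set" where
  "arrows C A B = {f \<in> Arr C. Dom C f = A \<and> Cod C f = B}"

locale category =
  fixes C :: "('o, 'm, 'z) precategory_scheme" (structure)
  assumes Dom_closed: "f \<in> Arr C \<Longrightarrow> Dom C f \<in> Ob C"
    and Cod_closed: "f \<in> Arr C \<Longrightarrow> Cod C f \<in> Ob C"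
    and ident_closed: "A \<in> Ob C \<Longrightarrow> ident C A \<in> arrows C A A"
    and comp_closed: "f \<in> arrows C B D \<Longrightarrow> g \<in> arrows C A B \<Longrightarrow> f \<cdot> g \<in> arrows C A D"
    and ident_left: "f \<in> arrows C A B \<Longrightarrow> ident C B \<cdot> f = f"
    and ident_right: "f \<in> arrows C A B \<Longrightarrow> f \<cdot> ident C A = f"
    and comp_assoc: "h \<in> arrows C D E \<Longrightarrow> g \<in> arrows C B D \<Longrightarrow> f \<in> arrows C A B
      \<Longrightarrow> h \<cdot> g \<cdot> f = h \<cdot> (g \<cdot> f)"

definition isos :: "('o, 'm, 'z) precategory_scheme \<Rightarrow> 'o \<Rightarrow> 'o \<Rightarrow> 'm set" where
  "isos C A B = {f \<in> arrows C A B. \<exists>g \<in> arrows C B A.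
     g \<cdot>\<^bsub>C\<^esub> f = ident C A \<and> f \<cdot>\<^bsub>C\<^esub> g = ident C B}"

text \<open>The forgetful functor sends an object A to the set \<open>pts C A\<close> and an arrow f to the
  function \<open>fn C f\<close>.  A function between sets is represented by an extensional function, so that
  equality of functions is equality in HOL and faithfulness is injectivity of \<open>fn C\<close> on each
  hom-set.\<close>

record ('o, 'm, 'u) concrete_precategory = "('o, 'm) precategory" +
  pts :: "'o \<Rightarrow> 'u set"
  fn :: "'m \<Rightarrow> 'u \<Rightarrow> 'u"

locale concrete_category = category C
  for C :: "('o, 'm, 'u, 'z) concrete_precategory_scheme" (structure) +
  assumes fn_closed: "f \<in> arrows C A B \<Longrightarrow> fn C f \<in> pts C A \<rightarrow>\<^sub>E pts C B"
    and fn_ident: "A \<in> Ob C \<Longrightarrow> fn C (ident C A) = (\<lambda>x\<in>pts C A. x)"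
    and fn_comp: "f \<in> arrows C B D \<Longrightarrow> g \<in> arrows C A B
      \<Longrightarrow> fn C (f \<cdot> g) = compose (pts C A) (fn C f) (fn C g)"
    and faithful: "inj_on (fn C) (arrows C A B)"

definition embeddings ::
    "('o, 'm, 'u, 'z) concrete_precategory_scheme \<Rightarrow> 'o \<Rightarrow> 'o \<Rightarrow> 'm set" where
  "embeddings C A B = {f \<in> arrows C A B.
     inj_on (fn C f) (pts C A) \<and>
     (\<forall>D \<in> Ob C. \<forall>g \<in> pts C D \<rightarrow>\<^sub>E pts C A.
        compose (pts C D) (fn C f) g \<in> fn C ` arrows C D B \<longrightarrow> g \<in> fn C ` arrows C D A)}"


section \<open>Simplicial complexes and cohomology\<close>

definition simplicial_complex :: "nat \<Rightarrow> nat set set \<Rightarrow> bool" where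
  "simplicial_complex n K \<longleftrightarrow>
     n \<ge> 1 \<and>
     (\<forall>\<sigma>\<in>K. \<sigma> \<noteq> {} \<and> \<sigma> \<subseteq> {1..n}) \<and>
     (\<forall>v\<in>{1..n}. {v} \<in> K) \<and>
     (\<forall>\<sigma>\<in>K. \<forall>\<rho>. \<rho> \<noteq> {} \<and> \<rho> \<subseteq> \<sigma> \<longrightarrow> \<rho> \<in> K)"

definition simplices :: "nat set set \<Rightarrow> nat \<Rightarrow> nat set set" where
  "simplices K k = {\<sigma>\<in>K. card \<sigma> = k + 1}"

text \<open>A coefficient system is given by groups \<open>A \<sigma>\<close> and maps
  \<open>\<alpha> \<sigma> \<tau>\<close> from \<open>A \<sigma>\<close> to \<open>A \<tau>\<close>; only
  the values for simplices \<open>\<sigma> \<subseteq> \<tau>\<close> are used.\<close>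

definition cochains ::
    "nat set set \<Rightarrow> (nat set \<Rightarrow> 'g monoid) \<Rightarrow> nat \<Rightarrow> (nat set \<Rightarrow> 'g) set" where
  "cochains K A k = (\<Pi>\<^sub>E \<sigma>\<in>simplices K k. carrier (A \<sigma>))"

definition cocycles1 ::
    "nat set set \<Rightarrow> (nat set \<Rightarrow> 'g monoid) \<Rightarrow> (nat set \<Rightarrow> nat set \<Rightarrow> 'g \<Rightarrow> 'g)
      \<Rightarrow> (nat set \<Rightarrow> 'g) set" where
  "cocycles1 K A \<alpha> = {a \<in> cochains K A 1.
     \<forall>i j k. i < j \<and> j < k \<and> {i,j,k} \<in> simplices K 2 \<longrightarrow>
       \<alpha> {j,k} {i,j,k} (inv\<^bsub>A {j,k}\<^esub> a {j,k})
         \<otimes>\<^bsub>A {i,j,k}\<^esub> \<alpha> {i,k} {i,j,k} (a {i,k})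
         \<otimes>\<^bsub>A {i,j,k}\<^esub> \<alpha> {i,j} {i,j,k} (inv\<^bsub>A {i,j}\<^esub> a {i,j})
       = \<one>\<^bsub>A {i,j,k}\<^esub>}"

text \<open>The right action of 0-cochains a on 1-cochains b.  An edge \<open>{i, j}\<close> with \<open>i < j\<close>
  has \<open>i = Min\<close> and \<open>j = Max\<close>.\<close>

definition cochain_act ::
    "nat set set \<Rightarrow> (nat set \<Rightarrow> 'g monoid) \<Rightarrow> (nat set \<Rightarrow> nat set \<Rightarrow> 'g \<Rightarrow> 'g)
      \<Rightarrow> (nat set \<Rightarrow> 'g) \<Rightarrow> (nat set \<Rightarrow> 'g) \<Rightarrow> nat set \<Rightarrow> 'g" where
  "cochain_act K A \<alpha> b a = (\<lambda>\<tau> \<in> simplices K 1.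
     let i = {Min \<tau>}; j = {Max \<tau>} in
       \<alpha> j \<tau> (inv\<^bsub>A j\<^esub> a j) \<otimes>\<^bsub>A \<tau>\<^esub> b \<tau> \<otimes>\<^bsub>A \<tau>\<^esub> \<alpha> i \<tau> (a i))"

definition H1 ::
    "nat set set \<Rightarrow> (nat set \<Rightarrow> 'g monoid) \<Rightarrow> (nat set \<Rightarrow> nat set \<Rightarrow> 'g \<Rightarrow> 'g)
      \<Rightarrow> (nat set \<Rightarrow> 'g) set set" where
  "H1 K A \<alpha> = (\<lambda>b. cochain_act K A \<alpha> b ` cochains K A 0) ` cocycles1 K A \<alpha>"


section \<open>Simplicial amalgams\<close>

text \<open>\<open>mor G \<sigma> \<tau>\<close> is the connecting morphism from \<open>obj G \<tau>\<close> to
  \<open>obj G \<sigma>\<close>, for \<open>\<sigma> \<subseteq> \<tau>\<close>.  Values at arguments that are not simplices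
  (or not nested) are irrelevant: no predicate below looks at them, and amalgams differing only there
  are isomorphic, hence in the same class.\<close>

record ('o, 'm) amalgam =
  obj :: "nat set \<Rightarrow> 'o"
  mor :: "nat set \<Rightarrow> nat set \<Rightarrow> 'm"

definition simplicial_amalgam ::
    "nat set set \<Rightarrow> ('o, 'm, 'u, 'z) concrete_precategory_scheme \<Rightarrow> ('o, 'm) amalgam \<Rightarrow> bool" where
  "simplicial_amalgam K C G \<longleftrightarrow>
     (\<forall>\<sigma>\<in>K. obj G \<sigma> \<in> Ob C) \<and>
     (\<forall>\<sigma>\<in>K. mor G \<sigma> \<sigma> = ident C (obj G \<sigma>)) \<and>
     (\<forall>\<rho>\<in>K. \<forall>\<sigma>\<in>K. \<forall>\<tau>\<in>K. \<rho> \<subseteq> \<sigma> \<and> \<sigma> \<subseteq> \<tau> \<longrightarrow>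
        mor G \<rho> \<sigma> \<cdot>\<^bsub>C\<^esub> mor G \<sigma> \<tau> = mor G \<rho> \<tau>) \<and>
     (\<forall>\<sigma>\<in>K. \<forall>\<tau>\<in>K. \<sigma> \<subseteq> \<tau> \<longrightarrow> mor G \<sigma> \<tau> \<in> embeddings C (obj G \<tau>) (obj G \<sigma>))"

definition img ::
    "('o, 'm, 'u, 'z) concrete_precategory_scheme \<Rightarrow> ('o, 'm) amalgam
      \<Rightarrow> nat set \<Rightarrow> nat set \<Rightarrow> 'u set" where
  "img C G \<sigma> \<tau> = fn C (mor G \<sigma> \<tau>) ` pts C (obj G \<tau>)"

definition amalgam_isomorphic ::
    "nat set set \<Rightarrow> ('o, 'm, 'u, 'z) concrete_precategory_scheme
      \<Rightarrow> ('o, 'm) amalgam \<Rightarrow> ('o, 'm) amalgam \<Rightarrow> bool" where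
  "amalgam_isomorphic K C G G' \<longleftrightarrow>
     (\<exists>\<phi>. (\<forall>\<sigma>\<in>K. \<phi> \<sigma> \<in> isos C (obj G \<sigma>) (obj G' \<sigma>)) \<and>
          (\<forall>\<sigma>\<in>K. \<forall>\<tau>\<in>K. \<sigma> \<subseteq> \<tau> \<longrightarrow>
             \<phi> \<sigma> \<cdot>\<^bsub>C\<^esub> mor G \<sigma> \<tau> = mor G' \<sigma> \<tau> \<cdot>\<^bsub>C\<^esub> \<phi> \<tau>))"

definition amalgams_of_type ::
    "nat set set \<Rightarrow> ('o, 'm, 'u, 'z) concrete_precategory_scheme
      \<Rightarrow> ('o, 'm) amalgam \<Rightarrow> ('o, 'm) amalgam set" where
  "amalgams_of_type K C G0 = {G. simplicial_amalgam K C G \<and>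
     (\<forall>\<sigma>\<in>K. obj G \<sigma> = obj G0 \<sigma>) \<and>
     (\<forall>\<sigma>\<in>K. \<forall>\<tau>\<in>K. \<sigma> \<subseteq> \<tau> \<longrightarrow> img C G \<sigma> \<tau> = img C G0 \<sigma> \<tau>)}"

definition iso_classes_of_type ::
    "nat set set \<Rightarrow> ('o, 'm, 'u, 'z) concrete_precategory_scheme
      \<Rightarrow> ('o, 'm) amalgam \<Rightarrow> ('o, 'm) amalgam set set" where
  "iso_classes_of_type K C G0 = amalgams_of_type K C G0 //
     {(G, G'). G \<in> amalgams_of_type K C G0 \<and> G' \<in> amalgams_of_type K C G0 \<and>
               amalgam_isomorphic K C G G'}"


section \<open>The coefficient system of an amalgam\<close>

definition coeff_group ::
    "nat set set \<Rightarrow> ('o, 'm, 'u, 'z) concrete_precategory_scheme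
      \<Rightarrow> ('o, 'm) amalgam \<Rightarrow> nat set \<Rightarrow> 'm monoid" where
  "coeff_group K C G \<sigma> =
     \<lparr>carrier = {g \<in> isos C (obj G \<sigma>) (obj G \<sigma>).
        \<forall>\<tau>\<in>K. \<sigma> \<subseteq> \<tau> \<longrightarrow> fn C g ` img C G \<sigma> \<tau> = img C G \<sigma> \<tau>},
      monoid.mult = comp C,
      one = ident C (obj G \<sigma>)\<rparr>"

text \<open>The morphism whose underlying function is \<open>\<psi>\<inverse> \<circ> f \<circ> \<psi>\<close> with
  \<open>\<psi> = mor G \<sigma> \<tau>\<close>; it is unique by faithfulness, and for f in
  \<open>coeff_group K C G \<sigma>\<close> it exists because \<open>\<psi>\<close> is an embedding.\<close>

definition coeff_map ::
    "('o, 'm, 'u, 'z) concrete_precategory_scheme \<Rightarrow> ('o, 'm) amalgam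
      \<Rightarrow> nat set \<Rightarrow> nat set \<Rightarrow> 'm \<Rightarrow> 'm" where
  "coeff_map C G \<sigma> \<tau> f =
     (THE h. h \<in> arrows C (obj G \<tau>) (obj G \<tau>) \<and>
        fn C h = (\<lambda>x \<in> pts C (obj G \<tau>).
          inv_into (pts C (obj G \<tau>)) (fn C (mor G \<sigma> \<tau>)) (fn C f (fn C (mor G \<sigma> \<tau>) x))))"

end

theory Submission
  imports Defs
begin

text \<open>An amalgam of type \<open>G0\<close> differs from \<open>G0\<close> by automorphisms: since the embeddings have the
  same images, its connecting morphisms are \<open>\<psi>\<^sub>\<sigma>\<^sub>\<tau> \<circ> c\<^sub>\<sigma>\<^sub>\<tau>\<close> for unique \<open>c\<^sub>\<sigma>\<^sub>\<tau> \<in> A\<^sub>\<tau>\<close>, and functoriality becomes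
  \<open>c\<^sub>\<rho>\<^sub>\<tau> = \<alpha>\<^sub>\<sigma>\<^sub>\<tau>(c\<^sub>\<rho>\<^sub>\<sigma>) c\<^sub>\<sigma>\<^sub>\<tau>\<close> (a twisting).  An isomorphism of two such amalgams is automatically a family
  \<open>\<phi>\<^sub>\<sigma> \<in> A\<^sub>\<sigma>\<close> with \<open>\<alpha>\<^sub>\<sigma>\<^sub>\<tau>(\<phi>\<^sub>\<sigma>) c\<^sub>\<sigma>\<^sub>\<tau> = c'\<^sub>\<sigma>\<^sub>\<tau> \<phi>\<^sub>\<tau>\<close>.  On an edge \<open>\<tau> = {i, j}\<close> with \<open>i < j\<close> put \<open>b\<^sub>\<tau> = c\<^sub>j\<^sub>\<tau> c\<^sub>i\<^sub>\<tau>\<inverse>\<close>; its image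
  in \<open>A\<^sub>\<rho>\<close> is \<open>c\<^sub>j\<^sub>\<rho> c\<^sub>i\<^sub>\<rho>\<inverse>\<close>, which yields the cocycle identity.  The components of \<open>\<phi>\<close> at the vertices act on \<open>b\<close> as the
  inverse of a 0-cochain and determine \<open>\<phi>\<close> through \<open>\<phi>\<^sub>\<tau> = c'\<^sub>i\<^sub>\<tau>\<inverse> \<alpha>\<^sub>i\<^sub>\<tau>(\<phi>\<^sub>i) c\<^sub>i\<^sub>\<tau>\<close> for any vertex \<open>i\<close> of \<open>\<tau>\<close>.\<close>

text \<open>The relation is the kernel of \<open>h\<close> on \<open>S\<close>, so its classes are
  the fibres of \<open>h\<close> and \<open>the_elem\<close> reads off the common value on a fibre.
  That \<open>P\<close> is an equivalence on \<open>S\<close> comes along with the hypothesis. This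
  turns a complete invariant into a bijection.\<close>

lemma bij_betw_quotient_kernel:
  assumes "\<And>x y. x \<in> S \<Longrightarrow> y \<in> S \<Longrightarrow> P x y \<longleftrightarrow> h x = h y"
  shows "bij_betw (\<lambda>X. the_elem (h ` X)) (S // {(x, y). x \<in> S \<and> y \<in> S \<and> P x y}) (h ` S)"
proof -
  let ?R = "{(x, y). x \<in> S \<and> y \<in> S \<and> P x y}"
  have cls: "?R `` {x} = {y \<in> S. h y = h x}" if "x \<in> S" for x
    using that by (auto simp: assms)
  have val: "the_elem (h ` (?R `` {x})) = h x" if "x \<in> S" for x
  proof -
    have "h ` (?R `` {x}) = {h x}" using that unfolding cls[OF that] by auto
    then show ?thesis by simp
  qed
  show ?thesis
    unfolding bij_betw_def
  proof
    show "inj_on (\<lambda>X. the_elem (h ` X)) (S // ?R)"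
    proof (rule inj_onI)
      fix X Y assume "X \<in> S // ?R" "Y \<in> S // ?R" and eq: "the_elem (h ` X) = the_elem (h ` Y)"
      then obtain x y where x: "x \<in> S" "X = ?R `` {x}" and y: "y \<in> S" "Y = ?R `` {y}"
        by (elim quotientE)
      have "h x = h y" using eq val[OF x(1)] val[OF y(1)] unfolding x(2) y(2) by simp
      then show "X = Y" unfolding x(2) y(2) cls[OF x(1)] cls[OF y(1)] by simp
    qed
    show "(\<lambda>X. the_elem (h ` X)) ` (S // ?R) = h ` S"
    proof -
      have "S // ?R = (\<lambda>x. ?R `` {x}) ` S" unfolding quotient_def by (rule UNION_singleton_eq_range)
      then show ?thesis using image_cong[OF refl val] by (simp only: image_image)
    qed
  qed
qed

section \<open>Cancellation in groups\<close>

context group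
begin

lemma mult_inv_cancel_left:
  "x \<in> carrier G \<Longrightarrow> y \<in> carrier G \<Longrightarrow> x \<otimes> (inv x \<otimes> y) = y"
  by (simp flip: m_assoc)

lemma inv_mult_cancel_left:
  "x \<in> carrier G \<Longrightarrow> y \<in> carrier G \<Longrightarrow> inv x \<otimes> (x \<otimes> y) = y"
  by (simp flip: m_assoc)

text \<open>A quotient does not see a common right factor. This removes
  \<open>c {i, j} \<tau>\<close> when edge values are pushed into a larger simplex, and
  \<open>\<phi> \<tau>\<close> when two twistings are compared.\<close>

lemma mult_inv_mult_cancel:
  assumes "x \<in> carrier G" "y \<in> carrier G" "z \<in> carrier G"
  shows "x \<otimes> z \<otimes> inv (y \<otimes> z) = x \<otimes> inv y"
  using assms by (simp add: inv_mult_group m_assoc mult_inv_cancel_left)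

lemma mult_inv_telescope:
  assumes "x \<in> carrier G" "y \<in> carrier G" "z \<in> carrier G"
  shows "x \<otimes> inv y \<otimes> (y \<otimes> inv z) = x \<otimes> inv z"
  using assms by (simp add: m_assoc inv_mult_cancel_left)

end


section \<open>Coefficient systems\<close>

text \<open>A functor from the simplices to groups, isolated so that the cohomological part is
  independent of \<open>C\<close>. The laws are required only on simplices and carrier elements,
  where \<open>coeff_map\<close> is under control.\<close>

locale coefficient_system =
  fixes n :: nat
    and K :: "nat set set"
    and A :: "nat set \<Rightarrow> 'g monoid"
    and \<alpha> :: "nat set \<Rightarrow> nat set \<Rightarrow> 'g \<Rightarrow> 'g"
  assumes complex: "simplicial_complex n K"
    and group: "\<sigma> \<in> K \<Longrightarrow> group (A \<sigma>)"
    and hom: "\<sigma> \<in> K \<Longrightarrow> \<tau> \<in> K \<Longrightarrow> \<sigma> \<subseteq> \<tau> \<Longrightarrow> \<alpha> \<sigma> \<tau> \<in> hom (A \<sigma>) (A \<tau>)"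
    and map_id: "\<sigma> \<in> K \<Longrightarrow> x \<in> carrier (A \<sigma>) \<Longrightarrow> \<alpha> \<sigma> \<sigma> x = x"
    and map_comp: "\<rho> \<in> K \<Longrightarrow> \<sigma> \<in> K \<Longrightarrow> \<tau> \<in> K \<Longrightarrow> \<rho> \<subseteq> \<sigma> \<Longrightarrow> \<sigma> \<subseteq> \<tau>
      \<Longrightarrow> x \<in> carrier (A \<rho>) \<Longrightarrow> \<alpha> \<sigma> \<tau> (\<alpha> \<rho> \<sigma> x) = \<alpha> \<rho> \<tau> x"
begin

lemma face: "\<sigma> \<in> K \<Longrightarrow> \<rho> \<noteq> {} \<Longrightarrow> \<rho> \<subseteq> \<sigma> \<Longrightarrow> \<rho> \<in> K"
  using complex unfolding simplicial_complex_def by blast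

lemma finite_simplex: "\<sigma> \<in> K \<Longrightarrow> finite \<sigma>"
  using complex unfolding simplicial_complex_def by (meson finite_atLeastAtMost finite_subset)

lemma simplex_nonempty: "\<sigma> \<in> K \<Longrightarrow> \<sigma> \<noteq> {}"
  using complex unfolding simplicial_complex_def by blast

lemma Min_in_simplex: "\<sigma> \<in> K \<Longrightarrow> Min \<sigma> \<in> \<sigma>"
  by (simp add: finite_simplex simplex_nonempty)

lemma vertex_in_K: "\<sigma> \<in> K \<Longrightarrow> i \<in> \<sigma> \<Longrightarrow> {i} \<in> K"
  by (rule face) auto

lemma edge_cases:
  assumes "\<tau> \<in> simplices K 1"
  obtains i j where "i < j" "\<tau> = {i, j}" "Min \<tau> = i" "Max \<tau> = j"
    "\<tau> \<in> K" "{i} \<in> K" "{j} \<in> K"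
proof -
  have \<tau>: "\<tau> \<in> K" "card \<tau> = 2" using assms by (auto simp: simplices_def)
  then obtain x y where "\<tau> = {x, y}" "x \<noteq> y" by (auto simp: card_2_iff)
  then obtain i j where ij: "\<tau> = {i, j}" "i < j"
    by (metis insert_commute linorder_neq_iff)
  with \<tau> show thesis using that[of i j] vertex_in_K[of \<tau>] by auto
qed

lemma edge_in_simplices: "i < j \<Longrightarrow> {i, j} \<in> K \<Longrightarrow> {i, j} \<in> simplices K 1"
  by (simp add: simplices_def)

lemma vertex_in_simplices: "{i} \<in> K \<Longrightarrow> {i} \<in> simplices K 0"
  by (simp add: simplices_def)

lemma map_closed:
  "\<sigma> \<in> K \<Longrightarrow> \<tau> \<in> K \<Longrightarrow> \<sigma> \<subseteq> \<tau> \<Longrightarrow> x \<in> carrier (A \<sigma>) \<Longrightarrow> \<alpha> \<sigma> \<tau> x \<in> carrier (A \<tau>)"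
  using hom unfolding hom_def by blast

lemma map_mult:
  "\<sigma> \<in> K \<Longrightarrow> \<tau> \<in> K \<Longrightarrow> \<sigma> \<subseteq> \<tau> \<Longrightarrow> x \<in> carrier (A \<sigma>) \<Longrightarrow> y \<in> carrier (A \<sigma>)
    \<Longrightarrow> \<alpha> \<sigma> \<tau> (x \<otimes>\<^bsub>A \<sigma>\<^esub> y) = \<alpha> \<sigma> \<tau> x \<otimes>\<^bsub>A \<tau>\<^esub> \<alpha> \<sigma> \<tau> y"
  using hom unfolding hom_def by blast

lemma map_group_hom: "\<sigma> \<in> K \<Longrightarrow> \<tau> \<in> K \<Longrightarrow> \<sigma> \<subseteq> \<tau> \<Longrightarrow> group_hom (A \<sigma>) (A \<tau>) (\<alpha> \<sigma> \<tau>)"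
  by (simp add: group_hom_def group_hom_axioms_def group hom)

lemma map_one: "\<sigma> \<in> K \<Longrightarrow> \<tau> \<in> K \<Longrightarrow> \<sigma> \<subseteq> \<tau> \<Longrightarrow> \<alpha> \<sigma> \<tau> \<one>\<^bsub>A \<sigma>\<^esub> = \<one>\<^bsub>A \<tau>\<^esub>"
  by (rule group_hom.hom_one[OF map_group_hom])

lemma map_inv:
  "\<sigma> \<in> K \<Longrightarrow> \<tau> \<in> K \<Longrightarrow> \<sigma> \<subseteq> \<tau> \<Longrightarrow> x \<in> carrier (A \<sigma>)
    \<Longrightarrow> \<alpha> \<sigma> \<tau> (inv\<^bsub>A \<sigma>\<^esub> x) = inv\<^bsub>A \<tau>\<^esub> (\<alpha> \<sigma> \<tau> x)"
  by (rule group_hom.hom_inv[OF map_group_hom])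

lemma cochain0_carrier: "a \<in> cochains K A 0 \<Longrightarrow> {i} \<in> K \<Longrightarrow> a {i} \<in> carrier (A {i})"
  unfolding cochains_def using vertex_in_simplices by (blast dest: PiE_mem)

lemma cochain1_carrier: "b \<in> cochains K A 1 \<Longrightarrow> \<tau> \<in> simplices K 1 \<Longrightarrow> b \<tau> \<in> carrier (A \<tau>)"
  unfolding cochains_def by (blast dest: PiE_mem)

lemma cochain0I:
  assumes "\<And>i. {i} \<in> K \<Longrightarrow> a {i} \<in> carrier (A {i})"
  shows "restrict a (simplices K 0) \<in> cochains K A 0"
  unfolding cochains_def using assms by (auto simp: simplices_def card_1_singleton_iff)

section \<open>The right action of 0-cochains on 1-cochains\<close>

lemma cochain_act_edge:
  "i < j \<Longrightarrow> {i, j} \<in> K \<Longrightarrow> cochain_act K A \<alpha> b a {i, j} =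
    \<alpha> {j} {i, j} (inv\<^bsub>A {j}\<^esub> a {j}) \<otimes>\<^bsub>A {i, j}\<^esub> b {i, j} \<otimes>\<^bsub>A {i, j}\<^esub> \<alpha> {i} {i, j} (a {i})"
  by (simp add: cochain_act_def Let_def edge_in_simplices del: One_nat_def)

lemma cochain_act_closed:
  assumes "b \<in> cochains K A 1" "a \<in> cochains K A 0"
  shows "cochain_act K A \<alpha> b a \<in> cochains K A 1"
  unfolding cochains_def
proof (rule PiE_I)
  fix \<tau> assume \<tau>: "\<tau> \<in> simplices K 1"
  then obtain i j where ij: "i < j" "\<tau> = {i, j}" "\<tau> \<in> K" "{i} \<in> K" "{j} \<in> K"
    by (rule edge_cases)
  interpret T: group "A {i, j}" using group[of "{i, j}"] ij by simp
  interpret J: group "A {j}" using group ij by blast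
  have "\<alpha> {j} \<tau> (inv\<^bsub>A {j}\<^esub> a {j}) \<in> carrier (A \<tau>)" "\<alpha> {i} \<tau> (a {i}) \<in> carrier (A \<tau>)"
    using ij assms(2) by (auto intro!: map_closed J.inv_closed cochain0_carrier)
  then show "cochain_act K A \<alpha> b a \<tau> \<in> carrier (A \<tau>)"
    using ij cochain1_carrier[OF assms(1) \<tau>] by (simp add: cochain_act_edge)
next
  fix \<tau> assume "\<tau> \<notin> simplices K 1"
  then show "cochain_act K A \<alpha> b a \<tau> = undefined" by (simp add: cochain_act_def)
qed

lemma cochain_act_one:
  assumes b: "b \<in> cochains K A 1"
  shows "cochain_act K A \<alpha> b (\<lambda>\<sigma>\<in>simplices K 0. \<one>\<^bsub>A \<sigma>\<^esub>) = b"
    (is "cochain_act K A \<alpha> b ?a = b")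
proof -
  have a: "?a \<in> cochains K A 0"
    by (rule cochain0I) (simp add: group group.is_monoid)
  show ?thesis
  proof (rule PiE_ext)
    show "cochain_act K A \<alpha> b ?a \<in> (\<Pi>\<^sub>E \<sigma>\<in>simplices K 1. carrier (A \<sigma>))"
      using cochain_act_closed[OF b a] by (simp add: cochains_def)
    show "b \<in> (\<Pi>\<^sub>E \<sigma>\<in>simplices K 1. carrier (A \<sigma>))" using b by (simp add: cochains_def)
  next
    fix \<tau> assume \<tau>: "\<tau> \<in> simplices K 1"
    then obtain i j where ij: "i < j" "\<tau> = {i, j}" "\<tau> \<in> K" "{i} \<in> K" "{j} \<in> K"
      by (rule edge_cases)
    interpret T: group "A {i, j}" using group[of "{i, j}"] ij by simp
    interpret J: group "A {j}" using group ij by blast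
    have "\<alpha> {j} \<tau> \<one>\<^bsub>A {j}\<^esub> = \<one>\<^bsub>A \<tau>\<^esub>" "\<alpha> {i} \<tau> \<one>\<^bsub>A {i}\<^esub> = \<one>\<^bsub>A \<tau>\<^esub>"
      using ij by (auto intro: map_one)
    then show "cochain_act K A \<alpha> b ?a \<tau> = b \<tau>"
      using ij cochain1_carrier[OF b \<tau>] vertex_in_simplices[of i] vertex_in_simplices[of j]
      by (simp add: cochain_act_edge)
  qed
qed

text \<open>The factor at the larger vertex is inverted and stands on the left, the one at the
  smaller vertex stands on the right. Since inversion reverses products, acting by \<open>a'\<close>
  after \<open>a\<close> places \<open>a'\<close> outermost on both sides, which is the action of
  the pointwise product.\<close>

lemma cochain_act_act:
  assumes b: "b \<in> cochains K A 1" and a: "a \<in> cochains K A 0" and a': "a' \<in> cochains K A 0"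
  shows "cochain_act K A \<alpha> (cochain_act K A \<alpha> b a) a' =
    cochain_act K A \<alpha> b (\<lambda>\<sigma>\<in>simplices K 0. a \<sigma> \<otimes>\<^bsub>A \<sigma>\<^esub> a' \<sigma>)" (is "?l = cochain_act K A \<alpha> b ?a")
proof (rule extensionalityI)
  show "?l \<in> extensional (simplices K 1)" "cochain_act K A \<alpha> b ?a \<in> extensional (simplices K 1)"
    by (auto simp: cochain_act_def)
next
  fix \<tau> assume \<tau>: "\<tau> \<in> simplices K 1"
  then obtain i j where ij: "i < j" "\<tau> = {i, j}" "\<tau> \<in> K" "{i} \<in> K" "{j} \<in> K"
    by (rule edge_cases)
  interpret T: group "A \<tau>" using group ij by blast
  interpret J: group "A {j}" using group ij by blast
  note carr = cochain0_carrier[OF a ij(4)] cochain0_carrier[OF a ij(5)]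
    cochain0_carrier[OF a' ij(4)] cochain0_carrier[OF a' ij(5)] cochain1_carrier[OF b \<tau>]
  have le: "{i} \<subseteq> \<tau>" "{j} \<subseteq> \<tau>" using ij by auto
  note simps = map_mult[OF ij(4,3) le(1)] map_mult[OF ij(5,3) le(2)]
     map_inv[OF ij(5,3) le(2)] map_closed[OF ij(4,3) le(1)] map_closed[OF ij(5,3) le(2)]
  show "?l \<tau> = cochain_act K A \<alpha> b ?a \<tau>"
    using carr ij(1,3) vertex_in_simplices[OF ij(4)] vertex_in_simplices[OF ij(5)]
    unfolding ij(2)
    by (simp add: cochain_act_edge simps[unfolded ij(2)] T.m_assoc[unfolded ij(2)]
        T.inv_mult_group[unfolded ij(2)] T.m_closed[unfolded ij(2)] T.inv_closed[unfolded ij(2)])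
qed

text \<open>Closure of 0-cochains under products gives one inclusion of orbits; the inverse of the
  acting cochain leads back from \<open>b'\<close> to \<open>b\<close>, so the same inclusion
  applies in the other direction.\<close>

lemma orbit_eq:
  assumes b: "b \<in> cochains K A 1" and b': "b' \<in> cochain_act K A \<alpha> b ` cochains K A 0"
  shows "cochain_act K A \<alpha> b' ` cochains K A 0 = cochain_act K A \<alpha> b ` cochains K A 0"
proof -
  have sub: "cochain_act K A \<alpha> y ` cochains K A 0 \<subseteq> cochain_act K A \<alpha> x ` cochains K A 0"
    if x: "x \<in> cochains K A 1" and y: "y \<in> cochain_act K A \<alpha> x ` cochains K A 0" for x y
  proof -
    obtain a where a: "a \<in> cochains K A 0" "y = cochain_act K A \<alpha> x a" using y by blast
    have "cochain_act K A \<alpha> y a' \<in> cochain_act K A \<alpha> x ` cochains K A 0"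
      if a': "a' \<in> cochains K A 0" for a'
    proof -
      have "(\<lambda>\<sigma>\<in>simplices K 0. a \<sigma> \<otimes>\<^bsub>A \<sigma>\<^esub> a' \<sigma>) \<in> cochains K A 0"
        using a(1) a' by (intro cochain0I) (simp add: cochain0_carrier group monoid.m_closed group.is_monoid)
      then show ?thesis using cochain_act_act[OF x a(1) a'] a(2) by simp
    qed
    then show ?thesis by blast
  qed
  obtain a where a: "a \<in> cochains K A 0" "b' = cochain_act K A \<alpha> b a" using b' by blast
  let ?a' = "\<lambda>\<sigma>\<in>simplices K 0. inv\<^bsub>A \<sigma>\<^esub> a \<sigma>"
  have a': "?a' \<in> cochains K A 0"
    using a(1) by (intro cochain0I) (simp add: cochain0_carrier group group.inv_closed)
  have "(\<lambda>\<sigma>\<in>simplices K 0. a \<sigma> \<otimes>\<^bsub>A \<sigma>\<^esub> ?a' \<sigma>) = (\<lambda>\<sigma>\<in>simplices K 0. \<one>\<^bsub>A \<sigma>\<^esub>)"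
  proof (rule restrict_ext)
    fix \<sigma> assume \<sigma>: "\<sigma> \<in> simplices K 0"
    then have "\<sigma> \<in> K" "a \<sigma> \<in> carrier (A \<sigma>)"
      using a(1) by (auto simp: simplices_def cochains_def)
    then show "a \<sigma> \<otimes>\<^bsub>A \<sigma>\<^esub> ?a' \<sigma> = \<one>\<^bsub>A \<sigma>\<^esub>" using \<sigma> by (simp add: group group.r_inv)
  qed
  then have "cochain_act K A \<alpha> b' ?a' = b"
    using cochain_act_act[OF b a(1) a'] cochain_act_one[OF b] a(2) by simp
  then have "b \<in> cochain_act K A \<alpha> b' ` cochains K A 0" using a' by (rule image_eqI[OF sym])
  moreover have "b' \<in> cochains K A 1" using cochain_act_closed[OF b a(1)] a(2) by simp
  ultimately show ?thesis by (intro equalityI sub b b')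
qed


section \<open>Twistings\<close>

definition twisting :: "(nat set \<Rightarrow> nat set \<Rightarrow> 'g) \<Rightarrow> bool" where
  "twisting c \<longleftrightarrow>
     (\<forall>\<sigma>\<in>K. \<forall>\<tau>\<in>K. \<sigma> \<subseteq> \<tau> \<longrightarrow> c \<sigma> \<tau> \<in> carrier (A \<tau>)) \<and>
     (\<forall>\<rho>\<in>K. \<forall>\<sigma>\<in>K. \<forall>\<tau>\<in>K. \<rho> \<subseteq> \<sigma> \<and> \<sigma> \<subseteq> \<tau> \<longrightarrow> c \<rho> \<tau> = \<alpha> \<sigma> \<tau> (c \<rho> \<sigma>) \<otimes>\<^bsub>A \<tau>\<^esub> c \<sigma> \<tau>)"

definition twist_equiv ::
    "(nat set \<Rightarrow> nat set \<Rightarrow> 'g) \<Rightarrow> (nat set \<Rightarrow> nat set \<Rightarrow> 'g) \<Rightarrow> bool" where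
  "twist_equiv c c' \<longleftrightarrow>
     (\<exists>\<phi>. (\<forall>\<sigma>\<in>K. \<phi> \<sigma> \<in> carrier (A \<sigma>)) \<and>
       (\<forall>\<sigma>\<in>K. \<forall>\<tau>\<in>K. \<sigma> \<subseteq> \<tau> \<longrightarrow> \<alpha> \<sigma> \<tau> (\<phi> \<sigma>) \<otimes>\<^bsub>A \<tau>\<^esub> c \<sigma> \<tau> = c' \<sigma> \<tau> \<otimes>\<^bsub>A \<tau>\<^esub> \<phi> \<tau>))"

definition edge_cochain :: "(nat set \<Rightarrow> nat set \<Rightarrow> 'g) \<Rightarrow> nat set \<Rightarrow> 'g" where
  "edge_cochain c = (\<lambda>\<tau>\<in>simplices K 1. c {Max \<tau>} \<tau> \<otimes>\<^bsub>A \<tau>\<^esub> inv\<^bsub>A \<tau>\<^esub> c {Min \<tau>} \<tau>)"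

lemma twisting_closed:
  "twisting c \<Longrightarrow> \<sigma> \<in> K \<Longrightarrow> \<tau> \<in> K \<Longrightarrow> \<sigma> \<subseteq> \<tau> \<Longrightarrow> c \<sigma> \<tau> \<in> carrier (A \<tau>)"
  unfolding twisting_def by blast

lemma twisting_comp:
  "twisting c \<Longrightarrow> \<rho> \<in> K \<Longrightarrow> \<sigma> \<in> K \<Longrightarrow> \<tau> \<in> K \<Longrightarrow> \<rho> \<subseteq> \<sigma> \<Longrightarrow> \<sigma> \<subseteq> \<tau>
    \<Longrightarrow> c \<rho> \<tau> = \<alpha> \<sigma> \<tau> (c \<rho> \<sigma>) \<otimes>\<^bsub>A \<tau>\<^esub> c \<sigma> \<tau>"
  unfolding twisting_def by blast

text \<open>For three equal simplices the twisting law makes \<open>c \<sigma> \<sigma>\<close>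
  idempotent, and a group has only one idempotent. This supplies the identity law of the functor
  built from a twisting.\<close>

lemma twisting_same:
  assumes "twisting c" "\<sigma> \<in> K"
  shows "c \<sigma> \<sigma> = \<one>\<^bsub>A \<sigma>\<^esub>"
proof -
  interpret group "A \<sigma>" using group assms by blast
  have "c \<sigma> \<sigma> \<in> carrier (A \<sigma>)" using twisting_closed assms by blast
  moreover have "c \<sigma> \<sigma> = c \<sigma> \<sigma> \<otimes>\<^bsub>A \<sigma>\<^esub> c \<sigma> \<sigma>"
    using twisting_comp[OF assms(1,2,2,2)] map_id[OF assms(2) calculation] by simp
  ultimately show ?thesis using r_cancel_one' by blast
qed

section \<open>From twistings to cocycles and back\<close>

lemma edge_cochain_edge:
  "i < j \<Longrightarrow> {i, j} \<in> K
    \<Longrightarrow> edge_cochain c {i, j} = c {j} {i, j} \<otimes>\<^bsub>A {i, j}\<^esub> inv\<^bsub>A {i, j}\<^esub> c {i} {i, j}"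
  by (simp add: edge_cochain_def edge_in_simplices del: One_nat_def)

text \<open>Passing through the edge writes both \<open>c {i} \<tau>\<close> and
  \<open>c {j} \<tau>\<close> as an image from the edge times the same factor
  \<open>c {i, j} \<tau>\<close>, which cancels in the quotient. All edges of a simplex can thus be
  compared in one group through values at vertices.\<close>

lemma map_edge_cochain:
  assumes c: "twisting c" and "i < j" and \<tau>: "\<tau> \<in> K" and ij: "{i, j} \<subseteq> \<tau>"
  shows "\<alpha> {i, j} \<tau> (edge_cochain c {i, j}) = c {j} \<tau> \<otimes>\<^bsub>A \<tau>\<^esub> inv\<^bsub>A \<tau>\<^esub> c {i} \<tau>"
proof -
  let ?e = "{i, j}"
  have K: "?e \<in> K" "{i} \<in> K" "{j} \<in> K" using \<tau> ij by (auto intro: face)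
  interpret T: group "A \<tau>" using group \<tau> by blast
  interpret E: group "A ?e" using group K by blast
  have carr: "c {i} ?e \<in> carrier (A ?e)" "c {j} ?e \<in> carrier (A ?e)" "c ?e \<tau> \<in> carrier (A \<tau>)"
    using twisting_closed[OF c] K \<tau> ij by auto
  have "c {j} \<tau> = \<alpha> ?e \<tau> (c {j} ?e) \<otimes>\<^bsub>A \<tau>\<^esub> c ?e \<tau>" "c {i} \<tau> = \<alpha> ?e \<tau> (c {i} ?e) \<otimes>\<^bsub>A \<tau>\<^esub> c ?e \<tau>"
    using twisting_comp[OF c K(3) K(1) \<tau> _ ij] twisting_comp[OF c K(2) K(1) \<tau> _ ij] by blast+
  then show ?thesis
    using carr \<open>i < j\<close> K \<tau> ij map_closed[OF K(1) \<tau> ij]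
    by (simp add: edge_cochain_edge map_mult map_inv T.mult_inv_mult_cancel)
qed

lemma edge_cochain_closed:
  assumes c: "twisting c"
  shows "edge_cochain c \<in> cochains K A 1"
  unfolding cochains_def
proof (rule PiE_I)
  fix \<tau> assume "\<tau> \<in> simplices K 1"
  then obtain i j where ij: "i < j" "\<tau> = {i, j}" "\<tau> \<in> K" "{i} \<in> K" "{j} \<in> K"
    by (rule edge_cases)
  interpret T: group "A {i, j}" using group[of "{i, j}"] ij by simp
  have "c {i} \<tau> \<in> carrier (A \<tau>)" "c {j} \<tau> \<in> carrier (A \<tau>)"
    using twisting_closed[OF c] ij by auto
  then show "edge_cochain c \<tau> \<in> carrier (A \<tau>)" using ij by (simp add: edge_cochain_edge)
next
  fix \<tau> assume "\<tau> \<notin> simplices K 1"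
  then show "edge_cochain c \<tau> = undefined" by (simp add: edge_cochain_def)
qed

text \<open>In the group of the triangle the three edges become quotients of the vertex values
  \<open>c {i} ?t\<close>, \<open>c {j} ?t\<close>, \<open>c {k} ?t\<close>, and the product in the
  cocycle condition telescopes.\<close>

lemma edge_cochain_cocycle:
  assumes c: "twisting c"
  shows "edge_cochain c \<in> cocycles1 K A \<alpha>"
  unfolding cocycles1_def
proof (intro CollectI conjI allI impI)
  show b: "edge_cochain c \<in> cochains K A 1" by (rule edge_cochain_closed[OF c])
  fix i j k assume "i < j \<and> j < k \<and> {i, j, k} \<in> simplices K 2"
  then have ijk: "i < j" "j < k" "{i, j, k} \<in> K" by (auto simp: simplices_def)
  let ?t = "{i, j, k}"
  interpret T: group "A ?t" using group ijk by blast
  have K: "{i, j} \<in> K" "{j, k} \<in> K" "{i, k} \<in> K" "{i} \<in> K" "{j} \<in> K" "{k} \<in> K"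
    using ijk(3) by (auto intro: face)
  have carr: "c {i} ?t \<in> carrier (A ?t)" "c {j} ?t \<in> carrier (A ?t)" "c {k} ?t \<in> carrier (A ?t)"
    using twisting_closed[OF c] ijk K by auto
  have ik: "i < k" using ijk by simp
  have inv: "\<alpha> e ?t (inv\<^bsub>A e\<^esub> edge_cochain c e) = inv\<^bsub>A ?t\<^esub> \<alpha> e ?t (edge_cochain c e)"
    if "e \<in> K" "e \<in> simplices K 1" "e \<subseteq> ?t" for e
    using that ijk(3) cochain1_carrier[OF b] by (intro map_inv) auto
  have "\<alpha> {j, k} ?t (edge_cochain c {j, k}) = c {k} ?t \<otimes>\<^bsub>A ?t\<^esub> inv\<^bsub>A ?t\<^esub> c {j} ?t"
    "\<alpha> {i, k} ?t (edge_cochain c {i, k}) = c {k} ?t \<otimes>\<^bsub>A ?t\<^esub> inv\<^bsub>A ?t\<^esub> c {i} ?t"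
    "\<alpha> {i, j} ?t (edge_cochain c {i, j}) = c {j} ?t \<otimes>\<^bsub>A ?t\<^esub> inv\<^bsub>A ?t\<^esub> c {i} ?t"
    using ijk ik by (auto intro!: map_edge_cochain[OF c])
  moreover have "{j, k} \<subseteq> ?t" "{i, j} \<subseteq> ?t" by auto
  ultimately show "\<alpha> {j, k} ?t (inv\<^bsub>A {j, k}\<^esub> edge_cochain c {j, k})
         \<otimes>\<^bsub>A ?t\<^esub> \<alpha> {i, k} ?t (edge_cochain c {i, k})
         \<otimes>\<^bsub>A ?t\<^esub> \<alpha> {i, j} ?t (inv\<^bsub>A {i, j}\<^esub> edge_cochain c {i, j})
       = \<one>\<^bsub>A ?t\<^esub>"
    using inv[OF K(1)] inv[OF K(2)] K edge_in_simplices[OF ijk(1)] edge_in_simplices[OF ijk(2)] carr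
    by (simp add: T.inv_mult_group T.mult_inv_telescope)
qed

text \<open>A cocycle comes from the twisting that is trivial on the inclusion of the least vertex of
  each simplex.\<close>

lemma edge_cochain_surj:
  assumes b: "b \<in> cocycles1 K A \<alpha>"
  obtains c where "twisting c" "edge_cochain c = b"
proof -
  have b1: "b \<in> cochains K A 1" using b by (simp add: cocycles1_def)
  \<comment> \<open>For \<open>p \<le> i\<close> the element \<open>e p i \<tau>\<close> plays the
    role of \<open>c {i} \<tau>\<close> divided by \<open>c {p} \<tau>\<close>, prescribed by
    \<open>b\<close> on the edge \<open>{p, i}\<close>; the identity covers the degenerate case
    \<open>p = i\<close>. Normalizing at the least vertex of \<open>\<tau>\<close> leaves
    \<open>c \<sigma> \<tau>\<close> as the value from \<open>Min \<tau>\<close> to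
    \<open>Min \<sigma>\<close>.\<close>
  define e where "e p i \<tau> = (if p = i then \<one>\<^bsub>A \<tau>\<^esub> else \<alpha> {p, i} \<tau> (b {p, i}))" for p i \<tau>
  define c where "c \<sigma> \<tau> = e (Min \<tau>) (Min \<sigma>) \<tau>" for \<sigma> \<tau>
  have bK: "{p, i} \<in> K \<and> b {p, i} \<in> carrier (A {p, i})" if "\<tau> \<in> K" "p < i" "p \<in> \<tau>" "i \<in> \<tau>" for p i \<tau>
    using that face[of \<tau> "{p, i}"] cochain1_carrier[OF b1] edge_in_simplices[of p i] by auto
  have e_closed: "e p i \<tau> \<in> carrier (A \<tau>)" if "\<tau> \<in> K" "p \<le> i" "p \<in> \<tau>" "i \<in> \<tau>" for p i \<tau>
  proof -
    interpret T: group "A \<tau>" using group that by blast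
    show ?thesis using bK[of \<tau> p i] map_closed[of "{p, i}" \<tau>] that by (auto simp: e_def)
  qed
  have map_e: "\<alpha> \<sigma> \<tau> (e p i \<sigma>) = e p i \<tau>"
    if "\<sigma> \<in> K" "\<tau> \<in> K" "\<sigma> \<subseteq> \<tau>" "p \<le> i" "p \<in> \<sigma>" "i \<in> \<sigma>" for p i \<sigma> \<tau>
    using that bK[of \<sigma> p i] map_comp[of "{p, i}" \<sigma> \<tau>] map_one[of \<sigma> \<tau>] by (auto simp: e_def)
  \<comment> \<open>This is the cocycle identity solved for the long edge \<open>{p, i}\<close>: it
    holds in the triangle \<open>{p, m, i}\<close> and is pushed forward to \<open>\<tau>\<close>.
    With the minima of \<open>\<tau>\<close>, \<open>\<sigma>\<close> and \<open>\<rho>\<close> as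
    \<open>p\<close>, \<open>m\<close> and \<open>i\<close> it becomes the twisting law.\<close>
  have e_comp: "e p i \<tau> = e m i \<tau> \<otimes>\<^bsub>A \<tau>\<^esub> e p m \<tau>"
    if \<tau>: "\<tau> \<in> K" and le: "p \<le> m" "m \<le> i" and "in": "p \<in> \<tau>" "m \<in> \<tau>" "i \<in> \<tau>" for p m i \<tau>
  proof -
    interpret T: group "A \<tau>" using group \<tau> by blast
    note carr = e_closed[OF \<tau> _ "in"(1,3)] e_closed[OF \<tau> le(1) "in"(1,2)] e_closed[OF \<tau> le(2) "in"(2,3)]
    consider "p = m" | "m = i" | "p < m" "m < i" using le by linarith
    then show ?thesis
    proof cases
      case 1 then show ?thesis using carr by (simp add: e_def)
    next
      case 2 then show ?thesis using carr by (simp add: e_def)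
    next
      case 3
      let ?t = "{p, m, i}"
      have t: "?t \<in> K" "?t \<subseteq> \<tau>" using \<tau> "in" face[of \<tau> ?t] by auto
      then have t2: "?t \<in> simplices K 2" using 3 by (auto simp: simplices_def)
      interpret S: group "A ?t" using group t by blast
      have eq: "\<alpha> {m, i} ?t (inv\<^bsub>A {m, i}\<^esub> b {m, i}) \<otimes>\<^bsub>A ?t\<^esub> \<alpha> {p, i} ?t (b {p, i})
         \<otimes>\<^bsub>A ?t\<^esub> \<alpha> {p, m} ?t (inv\<^bsub>A {p, m}\<^esub> b {p, m}) = \<one>\<^bsub>A ?t\<^esub>"
        using b t2 3 by (simp add: cocycles1_def)
      note sub = bK[OF t(1) 3(1)] bK[OF t(1) 3(2)] bK[OF t(1) order.strict_trans[OF 3]]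
      have x: "inv\<^bsub>A ?t\<^esub> e m i ?t \<otimes>\<^bsub>A ?t\<^esub> e p i ?t \<otimes>\<^bsub>A ?t\<^esub> inv\<^bsub>A ?t\<^esub> e p m ?t = \<one>\<^bsub>A ?t\<^esub>"
        using eq sub 3 t by (simp add: e_def map_inv)
      have tc: "e m i ?t \<in> carrier (A ?t)" "e p i ?t \<in> carrier (A ?t)" "e p m ?t \<in> carrier (A ?t)"
        using e_closed t 3 by auto
      have "inv\<^bsub>A ?t\<^esub> e m i ?t \<otimes>\<^bsub>A ?t\<^esub> e p i ?t = e p m ?t"
        using x tc by (metis S.inv_closed S.inv_equality S.inv_inv S.m_closed)
      then have "e p i ?t = e m i ?t \<otimes>\<^bsub>A ?t\<^esub> e p m ?t"
        using tc by (metis S.inv_solve_left)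
      then have "\<alpha> ?t \<tau> (e p i ?t) = \<alpha> ?t \<tau> (e m i ?t) \<otimes>\<^bsub>A \<tau>\<^esub> \<alpha> ?t \<tau> (e p m ?t)"
        using map_mult[OF t(1) \<tau> t(2)] tc by simp
      then show ?thesis using map_e[OF t(1) \<tau> t(2)] 3 by simp
    qed
  qed
  \<comment> \<open>Minima grow when passing to a face, so \<open>e\<close> is evaluated only at
    pairs in increasing order.\<close>
  have Min: "Min \<tau> \<le> Min \<sigma> \<and> Min \<sigma> \<in> \<tau> \<and> Min \<sigma> \<in> \<sigma> \<and> Min \<tau> \<in> \<tau>"
    if "\<sigma> \<in> K" "\<tau> \<in> K" "\<sigma> \<subseteq> \<tau>" for \<sigma> \<tau>
    using that Min_in_simplex[of \<sigma>] Min_in_simplex[of \<tau>] finite_simplex[of \<tau>] simplex_nonempty[of \<sigma>]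
    by (auto intro: Min_antimono)
  have "twisting c"
    unfolding twisting_def
  proof (intro conjI ballI impI)
    fix \<sigma> \<tau> assume "\<sigma> \<in> K" "\<tau> \<in> K" "\<sigma> \<subseteq> \<tau>"
    then show "c \<sigma> \<tau> \<in> carrier (A \<tau>)" using Min[of \<sigma> \<tau>] by (auto simp: c_def intro: e_closed)
  next
    fix \<rho> \<sigma> \<tau> assume K: "\<rho> \<in> K" "\<sigma> \<in> K" "\<tau> \<in> K" and le: "\<rho> \<subseteq> \<sigma> \<and> \<sigma> \<subseteq> \<tau>"
    have "\<alpha> \<sigma> \<tau> (c \<rho> \<sigma>) = e (Min \<sigma>) (Min \<rho>) \<tau>"
      unfolding c_def using K le Min[of \<rho> \<sigma>] by (intro map_e) auto
    then show "c \<rho> \<tau> = \<alpha> \<sigma> \<tau> (c \<rho> \<sigma>) \<otimes>\<^bsub>A \<tau>\<^esub> c \<sigma> \<tau>"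
      using e_comp[of \<tau> "Min \<tau>" "Min \<sigma>" "Min \<rho>"] K le Min[of \<rho> \<sigma>] Min[of \<sigma> \<tau>] by (auto simp: c_def)
  qed
  moreover have "edge_cochain c = b"
  proof (rule PiE_ext)
    show "edge_cochain c \<in> (\<Pi>\<^sub>E \<sigma>\<in>simplices K 1. carrier (A \<sigma>))"
      using edge_cochain_closed[OF \<open>twisting c\<close>] by (simp add: cochains_def)
    show "b \<in> (\<Pi>\<^sub>E \<sigma>\<in>simplices K 1. carrier (A \<sigma>))" using b1 by (simp add: cochains_def)
  next
    fix \<tau> assume \<tau>: "\<tau> \<in> simplices K 1"
    then obtain i j where ij: "i < j" "\<tau> = {i, j}" "\<tau> \<in> K" by (rule edge_cases)
    interpret T: group "A {i, j}" using group[of "{i, j}"] ij by simp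
    have "b \<tau> \<in> carrier (A \<tau>)" using cochain1_carrier[OF b1 \<tau>] .
    \<comment> \<open>On an edge, \<open>c\<close> is the identity at the smaller vertex and
      \<open>b \<tau>\<close> at the larger one, as \<alpha> from an edge to itself is
      trivial.\<close>
    then show "edge_cochain c \<tau> = b \<tau>"
      using ij by (simp add: edge_cochain_edge c_def e_def map_id)
  qed
  ultimately show thesis by (rule that)
qed

section \<open>Equivalence of twistings and orbits of cochains\<close>

lemma twist_equiv_imp_orbit:
  assumes c: "twisting c" and c': "twisting c'" and "twist_equiv c c'"
  shows "edge_cochain c' \<in> cochain_act K A \<alpha> (edge_cochain c) ` cochains K A 0"
proof -
  obtain \<phi> where \<phi>: "\<And>\<sigma>. \<sigma> \<in> K \<Longrightarrow> \<phi> \<sigma> \<in> carrier (A \<sigma>)"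
    and nat: "\<And>\<sigma> \<tau>. \<sigma> \<in> K \<Longrightarrow> \<tau> \<in> K \<Longrightarrow> \<sigma> \<subseteq> \<tau>
        \<Longrightarrow> \<alpha> \<sigma> \<tau> (\<phi> \<sigma>) \<otimes>\<^bsub>A \<tau>\<^esub> c \<sigma> \<tau> = c' \<sigma> \<tau> \<otimes>\<^bsub>A \<tau>\<^esub> \<phi> \<tau>"
    using assms(3) unfolding twist_equiv_def by blast
  \<comment> \<open>In the computation below \<open>\<phi>\<close> appears uninverted at the larger
    vertex, where the action inverts its cochain; hence the pointwise inverse of
    \<open>\<phi>\<close>.\<close>
  let ?a = "\<lambda>\<sigma>\<in>simplices K 0. inv\<^bsub>A \<sigma>\<^esub> \<phi> \<sigma>"
  have a: "?a \<in> cochains K A 0"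
    by (rule cochain0I) (simp add: group.inv_closed group \<phi>)
  have "edge_cochain c' = cochain_act K A \<alpha> (edge_cochain c) ?a"
  proof (rule extensionalityI)
    show "edge_cochain c' \<in> extensional (simplices K 1)"
      "cochain_act K A \<alpha> (edge_cochain c) ?a \<in> extensional (simplices K 1)"
      by (auto simp: edge_cochain_def cochain_act_def)
  next
    fix \<tau> assume "\<tau> \<in> simplices K 1"
    then obtain i j where ij: "i < j" "\<tau> = {i, j}" "\<tau> \<in> K" "{i} \<in> K" "{j} \<in> K"
      by (rule edge_cases)
    interpret T: group "A \<tau>" using group ij by blast
    interpret J: group "A {j}" using group ij by blast
    have le: "{i} \<subseteq> \<tau>" "{j} \<subseteq> \<tau>" using ij by auto
    note [simp] = twisting_closed[OF c ij(4,3) le(1)] twisting_closed[OF c ij(5,3) le(2)]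
      twisting_closed[OF c' ij(4,3) le(1)] twisting_closed[OF c' ij(5,3) le(2)]
      map_closed[OF ij(4,3) le(1)] map_closed[OF ij(5,3) le(2)]
      map_inv[OF ij(4,3) le(1)] \<phi>
    have "edge_cochain c' \<tau> = c' {j} \<tau> \<otimes>\<^bsub>A \<tau>\<^esub> inv\<^bsub>A \<tau>\<^esub> c' {i} \<tau>"
      using ij by (simp add: edge_cochain_edge)
    \<comment> \<open>Inserting \<open>\<phi> \<tau>\<close> into numerator and denominator creates
      the right-hand sides of naturality, which then replaces \<open>c'\<close> by \<open>c\<close>
      and leaves only the components of \<open>\<phi>\<close> at the two vertices.\<close>
    also have "\<dots> = (c' {j} \<tau> \<otimes>\<^bsub>A \<tau>\<^esub> \<phi> \<tau>) \<otimes>\<^bsub>A \<tau>\<^esub> inv\<^bsub>A \<tau>\<^esub> (c' {i} \<tau> \<otimes>\<^bsub>A \<tau>\<^esub> \<phi> \<tau>)"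
      using ij(3) by (simp add: T.mult_inv_mult_cancel)
    also have "\<dots> = (\<alpha> {j} \<tau> (\<phi> {j}) \<otimes>\<^bsub>A \<tau>\<^esub> c {j} \<tau>) \<otimes>\<^bsub>A \<tau>\<^esub> inv\<^bsub>A \<tau>\<^esub> (\<alpha> {i} \<tau> (\<phi> {i}) \<otimes>\<^bsub>A \<tau>\<^esub> c {i} \<tau>)"
      using nat[OF ij(4,3) le(1)] nat[OF ij(5,3) le(2)] by simp
    also have "\<dots> = \<alpha> {j} \<tau> (\<phi> {j}) \<otimes>\<^bsub>A \<tau>\<^esub> (c {j} \<tau> \<otimes>\<^bsub>A \<tau>\<^esub> inv\<^bsub>A \<tau>\<^esub> c {i} \<tau>)
        \<otimes>\<^bsub>A \<tau>\<^esub> \<alpha> {i} \<tau> (inv\<^bsub>A {i}\<^esub> \<phi> {i})"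
      using ij(4,5) by (simp add: T.inv_mult_group T.m_assoc)
    also have "\<dots> = cochain_act K A \<alpha> (edge_cochain c) ?a \<tau>"
      using ij vertex_in_simplices[OF ij(4)] vertex_in_simplices[OF ij(5)]
      by (simp add: cochain_act_edge edge_cochain_edge)
    finally show "edge_cochain c' \<tau> = cochain_act K A \<alpha> (edge_cochain c) ?a \<tau>" .
  qed
  then show ?thesis using a by (rule image_eqI)
qed

text \<open>Naturality along a vertex inclusion forces the component at \<open>\<tau>\<close> from
  the one at the vertex. The orbit equation on edges says that all vertices of \<open>\<tau>\<close>
  force the same element, and naturality between arbitrary simplices follows by comparing both at a
  common vertex.\<close>

lemma orbit_imp_twist_equiv:
  assumes c: "twisting c" and c': "twisting c'"
    and "edge_cochain c' \<in> cochain_act K A \<alpha> (edge_cochain c) ` cochains K A 0"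
  shows "twist_equiv c c'"
proof -
  obtain a where a: "a \<in> cochains K A 0" and act: "edge_cochain c' = cochain_act K A \<alpha> (edge_cochain c) a"
    using assms(3) by blast
  \<comment> \<open>The component at \<open>\<tau>\<close> forced by vertex \<open>i\<close> when
    the component at \<open>{i}\<close> is the inverse of \<open>a {i}\<close>.\<close>
  define x where "x i \<tau> = inv\<^bsub>A \<tau>\<^esub> c' {i} \<tau> \<otimes>\<^bsub>A \<tau>\<^esub> inv\<^bsub>A \<tau>\<^esub> \<alpha> {i} \<tau> (a {i}) \<otimes>\<^bsub>A \<tau>\<^esub> c {i} \<tau>" for i \<tau>
  have carr: "c {i} \<tau> \<in> carrier (A \<tau>)" "c' {i} \<tau> \<in> carrier (A \<tau>)"
    "\<alpha> {i} \<tau> (a {i}) \<in> carrier (A \<tau>)" "a {i} \<in> carrier (A {i})"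
    if "\<tau> \<in> K" "i \<in> \<tau>" for i \<tau>
    using that vertex_in_K[OF that] twisting_closed[OF c] twisting_closed[OF c'] map_closed[of "{i}" \<tau>]
      cochain0_carrier[OF a] by auto
  have x_closed: "x i \<tau> \<in> carrier (A \<tau>)" if "\<tau> \<in> K" "i \<in> \<tau>" for i \<tau>
  proof -
    interpret T: group "A \<tau>" using group that by blast
    show ?thesis using carr[OF that] by (simp add: x_def)
  qed
  have x_less: "x i \<tau> = x j \<tau>" if \<tau>: "\<tau> \<in> K" and ij: "i \<in> \<tau>" "j \<in> \<tau>" "i < j" for i j \<tau>
  proof -
    let ?e = "{i, j}"
    have e: "?e \<in> K" "?e \<subseteq> \<tau>" "{i} \<in> K" "{j} \<in> K" using ij \<tau> by (auto intro: face)
    interpret T: group "A \<tau>" using group \<tau> by blast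
    interpret E: group "A ?e" using group e by blast
    interpret J: group "A {j}" using group e by blast
    note ci = carr[OF \<tau> ij(1)] and cj = carr[OF \<tau> ij(2)]
    have "a {i} \<in> carrier (A {i})" "a {j} \<in> carrier (A {j})" using ci cj by auto
    then have ac: "\<alpha> {i} ?e (a {i}) \<in> carrier (A ?e)"
      "\<alpha> {j} ?e (inv\<^bsub>A {j}\<^esub> a {j}) \<in> carrier (A ?e)"
      using e by (auto intro!: map_closed)
    have bc: "edge_cochain c ?e \<in> carrier (A ?e)"
      using cochain1_carrier[OF edge_cochain_closed[OF c] edge_in_simplices[OF ij(3) e(1)]] .
    \<comment> \<open>The orbit equation is pushed from the edge into the group of
      \<open>\<tau>\<close>, where \<open>map_edge_cochain\<close> turns both edge cochains into
      quotients of vertex values. Solving for the inverse of \<open>c' {i} \<tau>\<close> then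
      rewrites \<open>x i \<tau>\<close> into \<open>x j \<tau>\<close>.\<close>
    have "\<alpha> ?e \<tau> (edge_cochain c' ?e) = \<alpha> ?e \<tau> (\<alpha> {j} ?e (inv\<^bsub>A {j}\<^esub> a {j}))
        \<otimes>\<^bsub>A \<tau>\<^esub> \<alpha> ?e \<tau> (edge_cochain c ?e) \<otimes>\<^bsub>A \<tau>\<^esub> \<alpha> ?e \<tau> (\<alpha> {i} ?e (a {i}))"
      unfolding act cochain_act_edge[OF ij(3) e(1)] using ac bc e \<tau> by (simp add: map_mult)
    also have "\<alpha> ?e \<tau> (\<alpha> {j} ?e (inv\<^bsub>A {j}\<^esub> a {j})) = inv\<^bsub>A \<tau>\<^esub> \<alpha> {j} \<tau> (a {j})"
      using e \<tau> ij cj by (simp add: map_comp map_inv map_closed)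
    also have "\<alpha> ?e \<tau> (\<alpha> {i} ?e (a {i})) = \<alpha> {i} \<tau> (a {i})"
      using e \<tau> ij ci by (simp add: map_comp)
    finally have "c' {j} \<tau> \<otimes>\<^bsub>A \<tau>\<^esub> inv\<^bsub>A \<tau>\<^esub> c' {i} \<tau> = inv\<^bsub>A \<tau>\<^esub> \<alpha> {j} \<tau> (a {j})
        \<otimes>\<^bsub>A \<tau>\<^esub> (c {j} \<tau> \<otimes>\<^bsub>A \<tau>\<^esub> inv\<^bsub>A \<tau>\<^esub> c {i} \<tau>) \<otimes>\<^bsub>A \<tau>\<^esub> \<alpha> {i} \<tau> (a {i})"
      using map_edge_cochain[OF c ij(3) \<tau> e(2)] map_edge_cochain[OF c' ij(3) \<tau> e(2)] by simp
    then have "inv\<^bsub>A \<tau>\<^esub> c' {i} \<tau> = inv\<^bsub>A \<tau>\<^esub> c' {j} \<tau> \<otimes>\<^bsub>A \<tau>\<^esub> (inv\<^bsub>A \<tau>\<^esub> \<alpha> {j} \<tau> (a {j})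
        \<otimes>\<^bsub>A \<tau>\<^esub> (c {j} \<tau> \<otimes>\<^bsub>A \<tau>\<^esub> inv\<^bsub>A \<tau>\<^esub> c {i} \<tau>) \<otimes>\<^bsub>A \<tau>\<^esub> \<alpha> {i} \<tau> (a {i}))"
      using ci cj by (simp add: T.inv_solve_left)
    then have "x i \<tau> = inv\<^bsub>A \<tau>\<^esub> c' {j} \<tau> \<otimes>\<^bsub>A \<tau>\<^esub> (inv\<^bsub>A \<tau>\<^esub> \<alpha> {j} \<tau> (a {j})
        \<otimes>\<^bsub>A \<tau>\<^esub> (c {j} \<tau> \<otimes>\<^bsub>A \<tau>\<^esub> inv\<^bsub>A \<tau>\<^esub> c {i} \<tau>) \<otimes>\<^bsub>A \<tau>\<^esub> \<alpha> {i} \<tau> (a {i}))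
         \<otimes>\<^bsub>A \<tau>\<^esub> inv\<^bsub>A \<tau>\<^esub> \<alpha> {i} \<tau> (a {i}) \<otimes>\<^bsub>A \<tau>\<^esub> c {i} \<tau>"
      by (simp add: x_def)
    also have "\<dots> = x j \<tau>"
      using ci cj by (simp add: x_def T.m_assoc T.mult_inv_cancel_left)
    finally show ?thesis .
  qed
  have x_eq: "x i \<tau> = x j \<tau>" if "\<tau> \<in> K" "i \<in> \<tau>" "j \<in> \<tau>" for i j \<tau>
    using that x_less by (metis linorder_neqE_nat)
  have nat: "\<alpha> \<sigma> \<tau> (x (Min \<sigma>) \<sigma>) \<otimes>\<^bsub>A \<tau>\<^esub> c \<sigma> \<tau> = c' \<sigma> \<tau> \<otimes>\<^bsub>A \<tau>\<^esub> x (Min \<tau>) \<tau>"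
    if K: "\<sigma> \<in> K" "\<tau> \<in> K" and le: "\<sigma> \<subseteq> \<tau>" for \<sigma> \<tau>
  proof -
    \<comment> \<open>The vertex \<open>Min \<sigma>\<close> lies in both simplices, and by
      \<open>x_eq\<close> it may replace \<open>Min \<tau>\<close> as the vertex used for
      \<open>\<tau>\<close>.\<close>
    define i where "i = Min \<sigma>"
    have i: "i \<in> \<sigma>" "i \<in> \<tau>" "{i} \<in> K" "{i} \<subseteq> \<sigma>"
      using Min_in_simplex K le vertex_in_K i_def by auto
    interpret T: group "A \<tau>" using group K by blast
    interpret S: group "A \<sigma>" using group K by blast
    note cs = carr[OF K(1) i(1)] and ct = carr[OF K(2) i(2)]
    have cl: "c \<sigma> \<tau> \<in> carrier (A \<tau>)" "c' \<sigma> \<tau> \<in> carrier (A \<tau>)"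
      using twisting_closed c c' K le by auto
    have xt: "x (Min \<tau>) \<tau> = x i \<tau>" using x_eq K i Min_in_simplex by blast
    have comp: "c {i} \<tau> = \<alpha> \<sigma> \<tau> (c {i} \<sigma>) \<otimes>\<^bsub>A \<tau>\<^esub> c \<sigma> \<tau>" "c' {i} \<tau> = \<alpha> \<sigma> \<tau> (c' {i} \<sigma>) \<otimes>\<^bsub>A \<tau>\<^esub> c' \<sigma> \<tau>"
      using twisting_comp[OF c i(3) K i(4) le] twisting_comp[OF c' i(3) K i(4) le] .
    have "\<alpha> \<sigma> \<tau> (x i \<sigma>) = inv\<^bsub>A \<tau>\<^esub> \<alpha> \<sigma> \<tau> (c' {i} \<sigma>) \<otimes>\<^bsub>A \<tau>\<^esub> inv\<^bsub>A \<tau>\<^esub> \<alpha> {i} \<tau> (a {i})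
        \<otimes>\<^bsub>A \<tau>\<^esub> \<alpha> \<sigma> \<tau> (c {i} \<sigma>)"
      using cs K le i by (simp add: x_def map_mult map_inv map_comp)
    then have "\<alpha> \<sigma> \<tau> (x i \<sigma>) \<otimes>\<^bsub>A \<tau>\<^esub> c \<sigma> \<tau> =
        inv\<^bsub>A \<tau>\<^esub> \<alpha> \<sigma> \<tau> (c' {i} \<sigma>) \<otimes>\<^bsub>A \<tau>\<^esub> inv\<^bsub>A \<tau>\<^esub> \<alpha> {i} \<tau> (a {i}) \<otimes>\<^bsub>A \<tau>\<^esub> c {i} \<tau>"
      using cs ct cl map_closed[OF K le] by (simp add: comp T.m_assoc)
    also have "\<dots> = c' \<sigma> \<tau> \<otimes>\<^bsub>A \<tau>\<^esub> x i \<tau>"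
      using cs ct cl map_closed[OF K le]
      by (simp add: x_def comp(2) T.inv_mult_group T.m_assoc T.mult_inv_cancel_left)
    finally show ?thesis unfolding xt i_def[symmetric] .
  qed
  then show ?thesis
    unfolding twist_equiv_def
    by (intro exI[of _ "\<lambda>\<sigma>. x (Min \<sigma>) \<sigma>"] conjI ballI impI nat x_closed Min_in_simplex)
qed

lemma twist_equiv_iff_orbits_eq:
  assumes c: "twisting c" and c': "twisting c'"
  shows "twist_equiv c c' \<longleftrightarrow>
    cochain_act K A \<alpha> (edge_cochain c) ` cochains K A 0 = cochain_act K A \<alpha> (edge_cochain c') ` cochains K A 0"
proof
  assume "twist_equiv c c'"
  then show "cochain_act K A \<alpha> (edge_cochain c) ` cochains K A 0 =
      cochain_act K A \<alpha> (edge_cochain c') ` cochains K A 0"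
    using orbit_eq[OF edge_cochain_closed[OF c] twist_equiv_imp_orbit[OF c c']] by simp
next
  assume eq: "cochain_act K A \<alpha> (edge_cochain c) ` cochains K A 0 =
      cochain_act K A \<alpha> (edge_cochain c') ` cochains K A 0"
  \<comment> \<open>The identity 0-cochain places \<open>edge_cochain c'\<close> in its own orbit,
    hence in the equal orbit of \<open>edge_cochain c\<close>.\<close>
  have "(\<lambda>\<sigma>\<in>simplices K 0. \<one>\<^bsub>A \<sigma>\<^esub>) \<in> cochains K A 0"
    by (rule cochain0I) (simp add: group group.is_monoid)
  then have "edge_cochain c' \<in> cochain_act K A \<alpha> (edge_cochain c') ` cochains K A 0"
    by (rule rev_image_eqI) (rule cochain_act_one[OF edge_cochain_closed[OF c'], symmetric])
  then show "twist_equiv c c'" using orbit_imp_twist_equiv[OF c c'] by (simp only: eq)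
qed

end


section \<open>Embeddings and isomorphisms\<close>

context concrete_category
begin

lemma arrows_Ob: "f \<in> arrows C A B \<Longrightarrow> A \<in> Ob C \<and> B \<in> Ob C"
  using Dom_closed Cod_closed by (auto simp: arrows_def)

lemma fn_comp_apply:
  "f \<in> arrows C B D \<Longrightarrow> g \<in> arrows C A B \<Longrightarrow> x \<in> pts C A \<Longrightarrow> fn C (f \<cdot> g) x = fn C f (fn C g x)"
  by (simp add: fn_comp compose_def)

lemma fn_apply_closed: "f \<in> arrows C A B \<Longrightarrow> x \<in> pts C A \<Longrightarrow> fn C f x \<in> pts C B"
  using fn_closed by (rule PiE_mem)

lemma fn_comp_image:
  assumes "f \<in> arrows C B D" "g \<in> arrows C A B" "S \<subseteq> pts C A"
  shows "fn C (f \<cdot> g) ` S = fn C f ` fn C g ` S"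
  unfolding image_image
  by (rule image_cong[OF refl]) (meson assms fn_comp_apply subsetD)

lemma arrow_eqI:
  assumes "f \<in> arrows C A B" "g \<in> arrows C A B" "\<And>x. x \<in> pts C A \<Longrightarrow> fn C f x = fn C g x"
  shows "f = g"
proof -
  have "fn C f = fn C g"
    using fn_closed[OF assms(1)] fn_closed[OF assms(2)] assms(3) by (rule PiE_ext)
  then show ?thesis by (rule inj_onD[OF faithful _ assms(1,2)])
qed

lemma isosE:
  assumes "f \<in> isos C A B"
  obtains g where "f \<in> arrows C A B" "g \<in> isos C B A" "g \<in> arrows C B A"
    "g \<cdot> f = ident C A" "f \<cdot> g = ident C B"
  using assms that unfolding isos_def by blast

lemma isosI:
  "f \<in> arrows C A B \<Longrightarrow> g \<in> arrows C B A \<Longrightarrow> g \<cdot> f = ident C A \<Longrightarrow> f \<cdot> g = ident C B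
    \<Longrightarrow> f \<in> isos C A B"
  unfolding isos_def by blast

lemma isos_arrows: "f \<in> isos C A B \<Longrightarrow> f \<in> arrows C A B"
  unfolding isos_def by blast

lemma ident_isos: "A \<in> Ob C \<Longrightarrow> ident C A \<in> isos C A A"
  by (rule isosI[OF ident_closed ident_closed ident_left[OF ident_closed] ident_left[OF ident_closed]])

lemma isos_comp:
  assumes "f \<in> isos C B D" "g \<in> isos C A B"
  shows "f \<cdot> g \<in> isos C A D"
proof -
  obtain f' where f: "f \<in> arrows C B D" "f' \<in> arrows C D B" "f' \<cdot> f = ident C B" "f \<cdot> f' = ident C D"
    using assms(1) by (rule isosE)
  obtain g' where g: "g \<in> arrows C A B" "g' \<in> arrows C B A" "g' \<cdot> g = ident C A" "g \<cdot> g' = ident C B"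
    using assms(2) by (rule isosE)
  have "g' \<cdot> f' \<cdot> (f \<cdot> g) = g' \<cdot> (f' \<cdot> (f \<cdot> g))"
    by (rule comp_assoc[OF g(2) f(2) comp_closed[OF f(1) g(1)]])
  also have "\<dots> = ident C A"
    using comp_assoc[OF f(2,1) g(1)] ident_left[OF g(1)] by (simp add: f g)
  finally have 1: "g' \<cdot> f' \<cdot> (f \<cdot> g) = ident C A" .
  have "f \<cdot> g \<cdot> (g' \<cdot> f') = f \<cdot> (g \<cdot> (g' \<cdot> f'))"
    by (rule comp_assoc[OF f(1) g(1) comp_closed[OF g(2) f(2)]])
  also have "\<dots> = ident C D"
    using comp_assoc[OF g(1,2) f(2)] ident_left[OF f(2)] by (simp add: f g)
  finally have 2: "f \<cdot> g \<cdot> (g' \<cdot> f') = ident C D" .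
  show ?thesis by (rule isosI[OF comp_closed[OF f(1) g(1)] comp_closed[OF g(2) f(2)] 1 2])
qed

lemma section_fn:
  assumes "f \<in> arrows C A B" "g \<in> arrows C B A" "g \<cdot> f = ident C A" "x \<in> pts C A"
  shows "fn C g (fn C f x) = x"
  using fn_comp_apply[OF assms(2,1,4)] arrows_Ob[OF assms(1)] assms(3,4) by (simp add: fn_ident)

lemma iso_image:
  assumes "f \<in> isos C A B"
  shows "fn C f ` pts C A = pts C B"
proof -
  obtain g where g: "f \<in> arrows C A B" "g \<in> arrows C B A" "f \<cdot> g = ident C B"
    using assms by (rule isosE)
  show ?thesis
  proof
    show "fn C f ` pts C A \<subseteq> pts C B" using fn_apply_closed[OF g(1)] by blast
    show "pts C B \<subseteq> fn C f ` pts C A"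
    proof
      fix y assume y: "y \<in> pts C B"
      show "y \<in> fn C f ` pts C A"
        using section_fn[OF g(2,1,3) y] fn_apply_closed[OF g(2) y] by (metis imageI)
    qed
  qed
qed

text \<open>A left inverse \<open>g\<close> recovers points, which gives injectivity; and if
  \<open>w\<close> has underlying function \<open>f\<close> after \<open>u\<close>, then
  \<open>g \<cdot> w\<close> has underlying function \<open>u\<close>, which gives
  initiality.\<close>

lemma iso_is_embedding:
  assumes "f \<in> isos C A B"
  shows "f \<in> embeddings C A B"
proof -
  obtain g where f: "f \<in> arrows C A B" and g: "g \<in> arrows C B A" "g \<cdot> f = ident C A"
    using assms by (rule isosE)
  have inj: "inj_on (fn C f) (pts C A)"
    by (rule inj_on_inverseI) (rule section_fn[OF f g])
  moreover have "u \<in> fn C ` arrows C D A"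
    if D: "D \<in> Ob C" and u: "u \<in> pts C D \<rightarrow>\<^sub>E pts C A"
      and fu: "compose (pts C D) (fn C f) u \<in> fn C ` arrows C D B" for D u
  proof -
    obtain w where w: "w \<in> arrows C D B" "compose (pts C D) (fn C f) u = fn C w" using fu by blast
    have "u = fn C (g \<cdot> w)"
    proof (rule PiE_ext[OF u fn_closed[OF comp_closed[OF g(1) w(1)]]])
      fix x assume x: "x \<in> pts C D"
      have "fn C w x = fn C f (u x)" using x by (simp add: w(2)[symmetric] compose_def)
      then show "u x = fn C (g \<cdot> w) x"
        using fn_comp_apply[OF g(1) w(1) x] section_fn[OF f g PiE_mem[OF u x]] by simp
    qed
    then show ?thesis using comp_closed[OF g(1) w(1)] by blast
  qed
  ultimately show ?thesis using f unfolding embeddings_def by blast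
qed

section \<open>Cancellation and factorization through embeddings\<close>

lemma embeddings_arrows: "f \<in> embeddings C A B \<Longrightarrow> f \<in> arrows C A B"
  unfolding embeddings_def by blast

lemma embeddings_inj: "f \<in> embeddings C A B \<Longrightarrow> inj_on (fn C f) (pts C A)"
  unfolding embeddings_def by blast

lemma embeddings_initial:
  "f \<in> embeddings C A B \<Longrightarrow> D \<in> Ob C \<Longrightarrow> u \<in> pts C D \<rightarrow>\<^sub>E pts C A
    \<Longrightarrow> compose (pts C D) (fn C f) u \<in> fn C ` arrows C D B \<Longrightarrow> u \<in> fn C ` arrows C D A"
  unfolding embeddings_def by blast

text \<open>Initiality is used twice: that of \<open>f\<close> lifts \<open>g\<close> after
  \<open>u\<close>, and then that of \<open>g\<close> lifts \<open>u\<close>.\<close>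

lemma embedding_comp:
  assumes f: "f \<in> embeddings C B E" and g: "g \<in> embeddings C A B"
  shows "f \<cdot> g \<in> embeddings C A E"
proof -
  note fa = embeddings_arrows[OF f] and ga = embeddings_arrows[OF g]
  have "inj_on (fn C (f \<cdot> g)) (pts C A)"
  proof (rule inj_onI)
    fix x y assume xy: "x \<in> pts C A" "y \<in> pts C A" "fn C (f \<cdot> g) x = fn C (f \<cdot> g) y"
    then have "fn C f (fn C g x) = fn C f (fn C g y)" using fn_comp_apply[OF fa ga] by simp
    then have "fn C g x = fn C g y"
      using inj_onD[OF embeddings_inj[OF f]] fn_apply_closed[OF ga] xy by blast
    then show "x = y" using inj_onD[OF embeddings_inj[OF g]] xy by blast
  qed
  moreover have "u \<in> fn C ` arrows C D A"
    if D: "D \<in> Ob C" and u: "u \<in> pts C D \<rightarrow>\<^sub>E pts C A"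
      and fgu: "compose (pts C D) (fn C (f \<cdot> g)) u \<in> fn C ` arrows C D E" for D u
  proof -
    let ?v = "compose (pts C D) (fn C g) u"
    have v: "?v \<in> pts C D \<rightarrow>\<^sub>E pts C B"
      using fn_apply_closed[OF ga] PiE_mem[OF u] by (auto simp: compose_def)
    have "compose (pts C D) (fn C f) ?v = compose (pts C D) (fn C (f \<cdot> g)) u"
      using fn_comp_apply[OF fa ga] PiE_mem[OF u] by (auto simp: compose_def)
    then have "compose (pts C D) (fn C f) ?v \<in> fn C ` arrows C D E" using fgu by simp
    then have "?v \<in> fn C ` arrows C D B" by (rule embeddings_initial[OF f D v])
    then show ?thesis by (rule embeddings_initial[OF g D u])
  qed
  ultimately show ?thesis using comp_closed[OF fa ga] unfolding embeddings_def by blast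
qed

text \<open>Injectivity cancels \<open>f\<close> at each point and faithfulness lifts the result to
  arrows. Equations of automorphisms are obtained below by comparing both sides after an
  embedding.\<close>

lemma embedding_mono:
  assumes f: "f \<in> embeddings C B D" and g: "g \<in> arrows C A B" and h: "h \<in> arrows C A B"
    and eq: "f \<cdot> g = f \<cdot> h"
  shows "g = h"
proof (rule arrow_eqI[OF g h])
  fix x assume x: "x \<in> pts C A"
  have "fn C f (fn C g x) = fn C f (fn C h x)"
    using fn_comp_apply[OF embeddings_arrows[OF f] g x] fn_comp_apply[OF embeddings_arrows[OF f] h x] eq
    by simp
  then show "fn C g x = fn C h x"
    using inj_onD[OF embeddings_inj[OF f]] fn_apply_closed g h x by blast
qed

text \<open>On points the factor is forced: follow \<open>k\<close>, then invert \<open>f\<close> on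
  its image. Initiality of \<open>f\<close> makes this function an arrow.\<close>

lemma embedding_factor:
  assumes f: "f \<in> embeddings C A B" and k: "k \<in> arrows C D B"
    and sub: "fn C k ` pts C D \<subseteq> fn C f ` pts C A"
  obtains g where "g \<in> arrows C D A" "f \<cdot> g = k"
proof -
  let ?u = "\<lambda>x\<in>pts C D. inv_into (pts C A) (fn C f) (fn C k x)"
  have u: "?u \<in> pts C D \<rightarrow>\<^sub>E pts C A"
    using sub by (auto intro!: inv_into_into)
  have fu: "fn C f (?u x) = fn C k x" if "x \<in> pts C D" for x
    using that sub by (simp add: f_inv_into_f image_subset_iff)
  have "compose (pts C D) (fn C f) ?u = fn C k"
  proof (rule extensionalityI[of _ "pts C D"])
    show "compose (pts C D) (fn C f) ?u \<in> extensional (pts C D)" by simp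
    show "fn C k \<in> extensional (pts C D)" using fn_closed[OF k] by (simp add: PiE_def)
    show "compose (pts C D) (fn C f) ?u x = fn C k x" if "x \<in> pts C D" for x
      using fu[OF that] that by (simp add: compose_def)
  qed
  then have "?u \<in> fn C ` arrows C D A"
    using embeddings_initial[OF f _ u] arrows_Ob[OF k] k by blast
  then obtain g where g: "g \<in> arrows C D A" "?u = fn C g" by blast
  have "f \<cdot> g = k"
  proof (rule arrow_eqI[OF comp_closed[OF embeddings_arrows[OF f] g(1)] k])
    fix x assume "x \<in> pts C D"
    then show "fn C (f \<cdot> g) x = fn C k x"
      using fn_comp_apply[OF embeddings_arrows[OF f] g(1)] fu g(2) by simp
  qed
  then show thesis using that g(1) by blast
qed

text \<open>Equal images let each embedding factor through the other; cancelling the embeddings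
  shows that the two factors are mutually inverse.\<close>

lemma embedding_factor_iso:
  assumes f: "f \<in> embeddings C A B" and k: "k \<in> embeddings C D B"
    and eq: "fn C k ` pts C D = fn C f ` pts C A"
  obtains g where "g \<in> isos C D A" "f \<cdot> g = k"
proof -
  note fa = embeddings_arrows[OF f] and ka = embeddings_arrows[OF k]
  obtain g where g: "g \<in> arrows C D A" "f \<cdot> g = k"
    using embedding_factor[OF f ka] eq by blast
  obtain h where h: "h \<in> arrows C A D" "k \<cdot> h = f"
    using embedding_factor[OF k fa] eq by blast
  have Ob: "A \<in> Ob C" "D \<in> Ob C" using arrows_Ob[OF g(1)] by auto
  have "f \<cdot> (g \<cdot> h) = f \<cdot> ident C A"
    using comp_assoc[OF fa g(1) h(1)] g h ident_right[OF fa] by simp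
  then have gh: "g \<cdot> h = ident C A"
    by (rule embedding_mono[OF f comp_closed[OF g(1) h(1)] ident_closed[OF Ob(1)]])
  have "k \<cdot> (h \<cdot> g) = k \<cdot> ident C D"
    using comp_assoc[OF ka h(1) g(1)] g h ident_right[OF ka] by simp
  then have "h \<cdot> g = ident C D"
    by (rule embedding_mono[OF k comp_closed[OF h(1) g(1)] ident_closed[OF Ob(2)]])
  then show thesis using that isosI[OF g(1) h(1) _ gh] g(2) by blast
qed

end


section \<open>Amalgams of a given type\<close>

lemma simplicial_amalgamD:
  assumes "simplicial_amalgam K C G"
  shows "\<And>\<sigma>. \<sigma> \<in> K \<Longrightarrow> obj G \<sigma> \<in> Ob C"
    and "\<And>\<sigma>. \<sigma> \<in> K \<Longrightarrow> mor G \<sigma> \<sigma> = ident C (obj G \<sigma>)"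
    and "\<And>\<rho> \<sigma> \<tau>. \<rho> \<in> K \<Longrightarrow> \<sigma> \<in> K \<Longrightarrow> \<tau> \<in> K \<Longrightarrow> \<rho> \<subseteq> \<sigma> \<Longrightarrow> \<sigma> \<subseteq> \<tau>
      \<Longrightarrow> mor G \<rho> \<sigma> \<cdot>\<^bsub>C\<^esub> mor G \<sigma> \<tau> = mor G \<rho> \<tau>"
    and "\<And>\<sigma> \<tau>. \<sigma> \<in> K \<Longrightarrow> \<tau> \<in> K \<Longrightarrow> \<sigma> \<subseteq> \<tau> \<Longrightarrow> mor G \<sigma> \<tau> \<in> embeddings C (obj G \<tau>) (obj G \<sigma>)"
  using assms by (simp_all add: simplicial_amalgam_def)

lemma amalgams_of_typeD:
  assumes "G \<in> amalgams_of_type K C G0"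
  shows "simplicial_amalgam K C G"
    and "\<And>\<sigma>. \<sigma> \<in> K \<Longrightarrow> obj G \<sigma> = obj G0 \<sigma>"
    and "\<And>\<sigma> \<tau>. \<sigma> \<in> K \<Longrightarrow> \<tau> \<in> K \<Longrightarrow> \<sigma> \<subseteq> \<tau> \<Longrightarrow> img C G \<sigma> \<tau> = img C G0 \<sigma> \<tau>"
  using assms by (simp_all add: amalgams_of_type_def)

locale amalgam_setup = concrete_category C
  for C :: "('o, 'm, 'u, 'z) concrete_precategory_scheme" (structure) +
  fixes n :: nat
    and K :: "nat set set"
    and G0 :: "('o, 'm) amalgam"
  assumes complex: "simplicial_complex n K"
    and amalgam: "simplicial_amalgam K C G0"
begin

abbreviation "A \<equiv> coeff_group K C G0"
abbreviation "\<alpha> \<equiv> coeff_map C G0"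
abbreviation "\<psi> \<equiv> mor G0"

lemmas obj_Ob = simplicial_amalgamD(1)[OF amalgam]
lemmas mor_same = simplicial_amalgamD(2)[OF amalgam]
lemmas mor_comp = simplicial_amalgamD(3)[OF amalgam]
lemmas mor_embedding = simplicial_amalgamD(4)[OF amalgam]
lemmas mor_arrow = embeddings_arrows[OF mor_embedding]

lemma img_subset: "\<sigma> \<in> K \<Longrightarrow> \<tau> \<in> K \<Longrightarrow> \<sigma> \<subseteq> \<tau> \<Longrightarrow> img C G0 \<sigma> \<tau> \<subseteq> pts C (obj G0 \<sigma>)"
  unfolding img_def by (rule image_subsetI) (rule fn_apply_closed[OF mor_arrow])

lemma mor_image_img:
  assumes "\<rho> \<in> K" "\<sigma> \<in> K" "\<tau> \<in> K" "\<rho> \<subseteq> \<sigma>" "\<sigma> \<subseteq> \<tau>"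
  shows "fn C (\<psi> \<rho> \<sigma>) ` img C G0 \<sigma> \<tau> = img C G0 \<rho> \<tau>"
  unfolding img_def mor_comp[OF assms, symmetric]
  by (rule fn_comp_image[OF mor_arrow mor_arrow subset_refl, symmetric]) fact+

section \<open>The automorphism groups form a coefficient system\<close>

lemma coeff_simps:
  "x \<otimes>\<^bsub>A \<sigma>\<^esub> y = x \<cdot> y" "\<one>\<^bsub>A \<sigma>\<^esub> = ident C (obj G0 \<sigma>)"
  by (simp_all add: coeff_group_def)

lemma coeff_iff:
  "f \<in> carrier (A \<sigma>) \<longleftrightarrow> f \<in> isos C (obj G0 \<sigma>) (obj G0 \<sigma>) \<and>
    (\<forall>\<tau>\<in>K. \<sigma> \<subseteq> \<tau> \<longrightarrow> fn C f ` img C G0 \<sigma> \<tau> = img C G0 \<sigma> \<tau>)"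
  by (simp add: coeff_group_def)

lemma coeff_isos: "f \<in> carrier (A \<sigma>) \<Longrightarrow> f \<in> isos C (obj G0 \<sigma>) (obj G0 \<sigma>)"
  by (simp add: coeff_iff)

lemmas coeff_arrows = isos_arrows[OF coeff_isos]

lemma coeff_img:
  "f \<in> carrier (A \<sigma>) \<Longrightarrow> \<tau> \<in> K \<Longrightarrow> \<sigma> \<subseteq> \<tau> \<Longrightarrow> fn C f ` img C G0 \<sigma> \<tau> = img C G0 \<sigma> \<tau>"
  by (simp add: coeff_iff)

lemma coeff_one_closed:
  assumes "\<sigma> \<in> K"
  shows "ident C (obj G0 \<sigma>) \<in> carrier (A \<sigma>)"
  unfolding coeff_iff
proof (intro conjI ballI impI ident_isos obj_Ob assms)
  fix \<tau> assume \<tau>: "\<tau> \<in> K" "\<sigma> \<subseteq> \<tau>"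
  have "fn C (ident C (obj G0 \<sigma>)) x = x" if "x \<in> img C G0 \<sigma> \<tau>" for x
    using that img_subset[OF assms \<tau>] by (simp add: fn_ident obj_Ob assms subsetD)
  then show "fn C (ident C (obj G0 \<sigma>)) ` img C G0 \<sigma> \<tau> = img C G0 \<sigma> \<tau>" by simp
qed

lemma coeff_mult_closed:
  assumes "\<sigma> \<in> K" and f: "f \<in> carrier (A \<sigma>)" and g: "g \<in> carrier (A \<sigma>)"
  shows "f \<cdot> g \<in> carrier (A \<sigma>)"
  unfolding coeff_iff
proof (intro conjI ballI impI isos_comp[OF coeff_isos[OF f] coeff_isos[OF g]])
  fix \<tau> assume \<tau>: "\<tau> \<in> K" "\<sigma> \<subseteq> \<tau>"
  show "fn C (f \<cdot> g) ` img C G0 \<sigma> \<tau> = img C G0 \<sigma> \<tau>"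
    using fn_comp_image[OF coeff_arrows[OF f] coeff_arrows[OF g] img_subset[OF assms(1) \<tau>]]
      coeff_img[OF f \<tau>] coeff_img[OF g \<tau>] by simp
qed

text \<open>Stabilizing is an equality of sets, so the categorical inverse applied to the image of
  \<open>img C G0 \<sigma> \<tau>\<close> under \<open>f\<close> returns the same set.\<close>

lemma coeff_inverse:
  assumes "\<sigma> \<in> K" and f: "f \<in> carrier (A \<sigma>)"
  obtains g where "g \<in> carrier (A \<sigma>)" "g \<cdot> f = ident C (obj G0 \<sigma>)" "f \<cdot> g = ident C (obj G0 \<sigma>)"
proof -
  obtain g where g: "g \<in> isos C (obj G0 \<sigma>) (obj G0 \<sigma>)" "g \<in> arrows C (obj G0 \<sigma>) (obj G0 \<sigma>)"
    "g \<cdot> f = ident C (obj G0 \<sigma>)" "f \<cdot> g = ident C (obj G0 \<sigma>)"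
    using coeff_isos[OF f] by (rule isosE)
  have "fn C g ` img C G0 \<sigma> \<tau> = img C G0 \<sigma> \<tau>" if \<tau>: "\<tau> \<in> K" "\<sigma> \<subseteq> \<tau>" for \<tau>
  proof -
    have "fn C g ` img C G0 \<sigma> \<tau> = fn C g ` fn C f ` img C G0 \<sigma> \<tau>" using coeff_img[OF f \<tau>] by simp
    also have "\<dots> = fn C (ident C (obj G0 \<sigma>)) ` img C G0 \<sigma> \<tau>"
      using fn_comp_image[OF g(2) coeff_arrows[OF f] img_subset[OF assms(1) \<tau>]] g(3) by simp
    also have "\<dots> = img C G0 \<sigma> \<tau>" by (rule coeff_img[OF coeff_one_closed[OF assms(1)] \<tau>])
    finally show ?thesis .
  qed
  then have "g \<in> carrier (A \<sigma>)" using g(1) by (simp add: coeff_iff)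
  then show thesis using that g(3,4) by blast
qed

lemma coeff_is_group:
  assumes "\<sigma> \<in> K"
  shows "group (A \<sigma>)"
proof (rule groupI, unfold coeff_simps)
  fix x y z assume "x \<in> carrier (A \<sigma>)" "y \<in> carrier (A \<sigma>)" "z \<in> carrier (A \<sigma>)"
  then show "x \<cdot> y \<cdot> z = x \<cdot> (y \<cdot> z)" by (rule comp_assoc[OF coeff_arrows coeff_arrows coeff_arrows])
next
  fix x assume x: "x \<in> carrier (A \<sigma>)"
  show "ident C (obj G0 \<sigma>) \<cdot> x = x" by (rule ident_left[OF coeff_arrows[OF x]])
  obtain y where "y \<in> carrier (A \<sigma>)" "y \<cdot> x = ident C (obj G0 \<sigma>)"
    using coeff_inverse[OF assms x] .
  then show "\<exists>y\<in>carrier (A \<sigma>). y \<cdot> x = ident C (obj G0 \<sigma>)" by (rule bexI[rotated])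
qed (fact coeff_one_closed[OF assms] coeff_mult_closed[OF assms])+

text \<open>As \<open>f\<close> preserves the image of \<open>\<psi> \<sigma> \<tau>\<close>, the
  arrow \<open>f \<cdot> \<psi> \<sigma> \<tau>\<close> factors through this embedding, and the
  factor satisfies the description in \<open>coeff_map\<close>. Afterwards
  \<open>\<alpha> \<sigma> \<tau> f\<close> is handled through the intertwining equation
  alone.\<close>

lemma coeff_map_arrow:
  assumes K: "\<sigma> \<in> K" "\<tau> \<in> K" and le: "\<sigma> \<subseteq> \<tau>" and f: "f \<in> carrier (A \<sigma>)"
  shows "\<alpha> \<sigma> \<tau> f \<in> arrows C (obj G0 \<tau>) (obj G0 \<tau>)" and "\<psi> \<sigma> \<tau> \<cdot> \<alpha> \<sigma> \<tau> f = f \<cdot> \<psi> \<sigma> \<tau>"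
proof -
  note e = mor_embedding[OF K le] and a = mor_arrow[OF K le]
  have "fn C (f \<cdot> \<psi> \<sigma> \<tau>) ` pts C (obj G0 \<tau>) = fn C (\<psi> \<sigma> \<tau>) ` pts C (obj G0 \<tau>)"
    using fn_comp_image[OF coeff_arrows[OF f] a subset_refl] coeff_img[OF f K(2) le]
    by (simp add: img_def)
  then obtain h where h: "h \<in> arrows C (obj G0 \<tau>) (obj G0 \<tau>)" "\<psi> \<sigma> \<tau> \<cdot> h = f \<cdot> \<psi> \<sigma> \<tau>"
    by (rule embedding_factor[OF e comp_closed[OF coeff_arrows[OF f] a] equalityD1])
  let ?u = "\<lambda>x \<in> pts C (obj G0 \<tau>).
    inv_into (pts C (obj G0 \<tau>)) (fn C (\<psi> \<sigma> \<tau>)) (fn C f (fn C (\<psi> \<sigma> \<tau>) x))"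
  have fh: "fn C h = ?u"
  proof (rule extensionalityI[of _ "pts C (obj G0 \<tau>)"])
    show "fn C h \<in> extensional (pts C (obj G0 \<tau>))" using fn_closed[OF h(1)] by (simp add: PiE_def)
    show "?u \<in> extensional (pts C (obj G0 \<tau>))" by simp
    fix x assume x: "x \<in> pts C (obj G0 \<tau>)"
    have "fn C f (fn C (\<psi> \<sigma> \<tau>) x) = fn C (\<psi> \<sigma> \<tau>) (fn C h x)"
      using fn_comp_apply[OF a h(1) x] fn_comp_apply[OF coeff_arrows[OF f] a x] h(2) by simp
    then show "fn C h x = ?u x"
      using inv_into_f_f[OF embeddings_inj[OF e] fn_apply_closed[OF h(1) x]] x by simp
  qed
  have "\<alpha> \<sigma> \<tau> f = h"
    unfolding coeff_map_def
  proof (rule the_equality)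
    show "h \<in> arrows C (obj G0 \<tau>) (obj G0 \<tau>) \<and> fn C h = ?u" using h(1) fh by (rule conjI)
    fix h' assume "h' \<in> arrows C (obj G0 \<tau>) (obj G0 \<tau>) \<and> fn C h' = ?u"
    then show "h' = h" by (intro inj_onD[OF faithful _ _ h(1)]) (simp_all add: fh)
  qed
  then show "\<alpha> \<sigma> \<tau> f \<in> arrows C (obj G0 \<tau>) (obj G0 \<tau>)" and "\<psi> \<sigma> \<tau> \<cdot> \<alpha> \<sigma> \<tau> f = f \<cdot> \<psi> \<sigma> \<tau>"
    using h by simp_all
qed

text \<open>The embedding can be cancelled, so the intertwining equation characterizes the value.
  The functor laws of \<alpha> reduce in this way to pasting commutative squares.\<close>

lemma coeff_map_eqI:
  assumes "\<sigma> \<in> K" "\<tau> \<in> K" "\<sigma> \<subseteq> \<tau>" "f \<in> carrier (A \<sigma>)"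
    and "h \<in> arrows C (obj G0 \<tau>) (obj G0 \<tau>)" "\<psi> \<sigma> \<tau> \<cdot> h = f \<cdot> \<psi> \<sigma> \<tau>"
  shows "\<alpha> \<sigma> \<tau> f = h"
  by (rule embedding_mono[OF mor_embedding[OF assms(1-3)] coeff_map_arrow(1)[OF assms(1-4)] assms(5)])
    (simp only: coeff_map_arrow(2)[OF assms(1-4)] assms(6))

lemma coeff_map_one:
  assumes "\<sigma> \<in> K" "\<tau> \<in> K" "\<sigma> \<subseteq> \<tau>"
  shows "\<alpha> \<sigma> \<tau> (ident C (obj G0 \<sigma>)) = ident C (obj G0 \<tau>)"
  using ident_left[OF mor_arrow[OF assms]] ident_right[OF mor_arrow[OF assms]]
  by (intro coeff_map_eqI coeff_one_closed ident_closed obj_Ob assms) simp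

lemma coeff_map_mult:
  assumes K: "\<sigma> \<in> K" "\<tau> \<in> K" "\<sigma> \<subseteq> \<tau>" and f: "f \<in> carrier (A \<sigma>)" and g: "g \<in> carrier (A \<sigma>)"
  shows "\<alpha> \<sigma> \<tau> (f \<cdot> g) = \<alpha> \<sigma> \<tau> f \<cdot> \<alpha> \<sigma> \<tau> g"
proof (rule coeff_map_eqI[OF K coeff_mult_closed[OF K(1) f g]])
  note a = mor_arrow[OF K] and fm = coeff_map_arrow[OF K f] and gm = coeff_map_arrow[OF K g]
  show "\<alpha> \<sigma> \<tau> f \<cdot> \<alpha> \<sigma> \<tau> g \<in> arrows C (obj G0 \<tau>) (obj G0 \<tau>)"
    by (rule comp_closed[OF fm(1) gm(1)])
  have "\<psi> \<sigma> \<tau> \<cdot> (\<alpha> \<sigma> \<tau> f \<cdot> \<alpha> \<sigma> \<tau> g) = f \<cdot> \<psi> \<sigma> \<tau> \<cdot> \<alpha> \<sigma> \<tau> g"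
    using comp_assoc[OF a fm(1) gm(1)] fm(2) by simp
  also have "\<dots> = f \<cdot> (g \<cdot> \<psi> \<sigma> \<tau>)"
    using comp_assoc[OF coeff_arrows[OF f] a gm(1)] gm(2) by simp
  also have "\<dots> = f \<cdot> g \<cdot> \<psi> \<sigma> \<tau>"
    using comp_assoc[OF coeff_arrows[OF f] coeff_arrows[OF g] a] by simp
  finally show "\<psi> \<sigma> \<tau> \<cdot> (\<alpha> \<sigma> \<tau> f \<cdot> \<alpha> \<sigma> \<tau> g) = f \<cdot> g \<cdot> \<psi> \<sigma> \<tau>" .
qed

text \<open>Images under the injective map \<open>\<psi> \<sigma> \<tau>\<close> can be compared in \<open>obj G0 \<sigma>\<close>.\<close>

lemma img_eqI:
  assumes K: "\<sigma> \<in> K" "\<tau> \<in> K" "\<sigma> \<subseteq> \<tau>" and S: "S \<subseteq> pts C (obj G0 \<tau>)" and \<rho>: "\<rho> \<in> K" "\<tau> \<subseteq> \<rho>"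
    and eq: "fn C (\<psi> \<sigma> \<tau>) ` S = img C G0 \<sigma> \<rho>"
  shows "S = img C G0 \<tau> \<rho>"
proof -
  have "fn C (\<psi> \<sigma> \<tau>) ` S = fn C (\<psi> \<sigma> \<tau>) ` img C G0 \<tau> \<rho>"
    using eq mor_image_img[OF K(1,2) \<rho>(1) K(3) \<rho>(2)] by simp
  then show ?thesis
    by (rule iffD1[OF inj_on_image_eq_iff[OF embeddings_inj[OF mor_embedding[OF K]] S img_subset[OF K(2) \<rho>]]])
qed

text \<open>Multiplicativity carries an inverse of \<open>f\<close> to one of
  \<open>\<alpha> \<sigma> \<tau> f\<close>. Preservation of \<open>img C G0 \<tau> \<rho>\<close>
  is tested in \<open>obj G0 \<sigma>\<close>, where it becomes preservation of
  \<open>img C G0 \<sigma> \<rho>\<close> by \<open>f\<close>.\<close>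

lemma coeff_map_closed:
  assumes K: "\<sigma> \<in> K" "\<tau> \<in> K" "\<sigma> \<subseteq> \<tau>" and f: "f \<in> carrier (A \<sigma>)"
  shows "\<alpha> \<sigma> \<tau> f \<in> carrier (A \<tau>)"
  unfolding coeff_iff
proof (intro conjI ballI impI)
  obtain g where g: "g \<in> carrier (A \<sigma>)" "g \<cdot> f = ident C (obj G0 \<sigma>)" "f \<cdot> g = ident C (obj G0 \<sigma>)"
    using coeff_inverse[OF K(1) f] by blast
  note a = mor_arrow[OF K] and fm = coeff_map_arrow[OF K f] and gm = coeff_map_arrow[OF K g(1)]
  show "\<alpha> \<sigma> \<tau> f \<in> isos C (obj G0 \<tau>) (obj G0 \<tau>)"
    using coeff_map_mult[OF K f g(1)] coeff_map_mult[OF K g(1) f] coeff_map_one[OF K] g(2,3)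
    by (intro isosI[OF fm(1) gm(1)]) simp_all
  fix \<rho> assume \<rho>: "\<rho> \<in> K" "\<tau> \<subseteq> \<rho>"
  have le: "\<sigma> \<subseteq> \<rho>" using K \<rho> by blast
  note s = img_subset[OF K(2) \<rho>]
  have "fn C (\<psi> \<sigma> \<tau>) ` fn C (\<alpha> \<sigma> \<tau> f) ` img C G0 \<tau> \<rho> = fn C f ` fn C (\<psi> \<sigma> \<tau>) ` img C G0 \<tau> \<rho>"
    using fn_comp_image[OF a fm(1) s] fn_comp_image[OF coeff_arrows[OF f] a s] fm(2) by simp
  also have "\<dots> = img C G0 \<sigma> \<rho>"
    using mor_image_img[OF K(1,2) \<rho>(1) K(3) \<rho>(2)] coeff_img[OF f \<rho>(1) le] by simp
  finally show "fn C (\<alpha> \<sigma> \<tau> f) ` img C G0 \<tau> \<rho> = img C G0 \<tau> \<rho>"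
    by (intro img_eqI[OF K _ \<rho>] image_subsetI fn_apply_closed[OF fm(1)] subsetD[OF s])
qed

lemma coeff_map_comp:
  assumes K: "\<rho> \<in> K" "\<sigma> \<in> K" "\<tau> \<in> K" and le: "\<rho> \<subseteq> \<sigma>" "\<sigma> \<subseteq> \<tau>" and f: "f \<in> carrier (A \<rho>)"
  shows "\<alpha> \<sigma> \<tau> (\<alpha> \<rho> \<sigma> f) = \<alpha> \<rho> \<tau> f"
proof (rule sym, rule coeff_map_eqI[OF K(1,3) _ f])
  note fm = coeff_map_arrow[OF K(1,2) le(1) f]
    and fmm = coeff_map_arrow[OF K(2,3) le(2) coeff_map_closed[OF K(1,2) le(1) f]]
    and a = mor_arrow[OF K(1,2) le(1)] and b = mor_arrow[OF K(2,3) le(2)]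
  show "\<alpha> \<sigma> \<tau> (\<alpha> \<rho> \<sigma> f) \<in> arrows C (obj G0 \<tau>) (obj G0 \<tau>)" by (rule fmm(1))
  have "\<psi> \<rho> \<tau> \<cdot> \<alpha> \<sigma> \<tau> (\<alpha> \<rho> \<sigma> f) = \<psi> \<rho> \<sigma> \<cdot> (\<psi> \<sigma> \<tau> \<cdot> \<alpha> \<sigma> \<tau> (\<alpha> \<rho> \<sigma> f))"
    using comp_assoc[OF a b fmm(1)] mor_comp[OF K le] by simp
  also have "\<dots> = \<psi> \<rho> \<sigma> \<cdot> \<alpha> \<rho> \<sigma> f \<cdot> \<psi> \<sigma> \<tau>"
    using comp_assoc[OF a fm(1) b] fmm(2) by simp
  also have "\<dots> = f \<cdot> \<psi> \<rho> \<tau>"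
    using comp_assoc[OF coeff_arrows[OF f] a b] fm(2) mor_comp[OF K le] by simp
  finally show "\<psi> \<rho> \<tau> \<cdot> \<alpha> \<sigma> \<tau> (\<alpha> \<rho> \<sigma> f) = f \<cdot> \<psi> \<rho> \<tau>" .
qed (use le in blast)

sublocale coefficient_system n K A \<alpha>
proof (rule coefficient_system.intro)
  fix \<sigma> x assume \<sigma>: "\<sigma> \<in> K" and x: "x \<in> carrier (A \<sigma>)"
  note a = coeff_arrows[OF x]
  show "\<alpha> \<sigma> \<sigma> x = x"
    by (rule coeff_map_eqI[OF \<sigma> \<sigma> subset_refl x a])
      (simp add: mor_same \<sigma> ident_left[OF a] ident_right[OF a])
next
  fix \<sigma> \<tau> assume "\<sigma> \<in> K" "\<tau> \<in> K" "\<sigma> \<subseteq> \<tau>"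
  then show "\<alpha> \<sigma> \<tau> \<in> hom (A \<sigma>) (A \<tau>)"
    by (auto simp: hom_def coeff_simps coeff_map_closed coeff_map_mult)
qed (fact complex coeff_is_group coeff_map_comp)+

section \<open>Amalgams of type \<open>G0\<close> and twistings\<close>

definition realizes :: "('o, 'm) amalgam \<Rightarrow> (nat set \<Rightarrow> nat set \<Rightarrow> 'm) \<Rightarrow> bool" where
  "realizes G c \<longleftrightarrow> (\<forall>\<sigma>\<in>K. obj G \<sigma> = obj G0 \<sigma>) \<and>
    (\<forall>\<sigma>\<in>K. \<forall>\<tau>\<in>K. \<sigma> \<subseteq> \<tau> \<longrightarrow> mor G \<sigma> \<tau> = \<psi> \<sigma> \<tau> \<cdot> c \<sigma> \<tau>)"

lemma mor_eq: "realizes G c \<Longrightarrow> \<sigma> \<in> K \<Longrightarrow> \<tau> \<in> K \<Longrightarrow> \<sigma> \<subseteq> \<tau> \<Longrightarrow> mor G \<sigma> \<tau> = \<psi> \<sigma> \<tau> \<cdot> c \<sigma> \<tau>"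
  unfolding realizes_def by blast

text \<open>Moving \<open>x\<close> across \<open>\<psi> \<sigma> \<tau>\<close> replaces it by
  \<open>\<alpha> \<sigma> \<tau> x\<close>. This rule is why composition of the altered morphisms
  corresponds to the twisting law.\<close>

lemma twisted_comp:
  assumes K: "\<rho> \<in> K" "\<sigma> \<in> K" "\<tau> \<in> K" and le: "\<rho> \<subseteq> \<sigma>" "\<sigma> \<subseteq> \<tau>"
    and x: "x \<in> carrier (A \<sigma>)" and y: "y \<in> arrows C (obj G0 \<tau>) (obj G0 \<tau>)"
  shows "(\<psi> \<rho> \<sigma> \<cdot> x) \<cdot> (\<psi> \<sigma> \<tau> \<cdot> y) = \<psi> \<rho> \<tau> \<cdot> (\<alpha> \<sigma> \<tau> x \<cdot> y)"
proof -
  note a = mor_arrow[OF K(1,2) le(1)] and b = mor_arrow[OF K(2,3) le(2)]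
    and c = mor_arrow[OF K(1,3) order_trans[OF le]]
    and xa = coeff_arrows[OF x] and xm = coeff_map_arrow[OF K(2,3) le(2) x]
  have "(\<psi> \<rho> \<sigma> \<cdot> x) \<cdot> (\<psi> \<sigma> \<tau> \<cdot> y) = \<psi> \<rho> \<sigma> \<cdot> (x \<cdot> \<psi> \<sigma> \<tau>) \<cdot> y"
    using comp_assoc[OF comp_closed[OF a xa] b y] comp_assoc[OF a xa b] by simp
  also have "\<dots> = \<psi> \<rho> \<tau> \<cdot> \<alpha> \<sigma> \<tau> x \<cdot> y"
    using comp_assoc[OF a b xm(1)] mor_comp[OF K le] xm(2) by simp
  also have "\<dots> = \<psi> \<rho> \<tau> \<cdot> (\<alpha> \<sigma> \<tau> x \<cdot> y)" by (rule comp_assoc[OF c xm(1) y])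
  finally show ?thesis .
qed

text \<open>Equal images let each morphism of \<open>G\<close> factor as
  \<open>\<psi> \<sigma> \<tau>\<close> after an automorphism. Functoriality of \<open>G\<close>,
  followed by cancelling an embedding, shows both that the automorphism lies in the coefficient
  group and that the twisting law holds.\<close>

lemma amalgam_realizes_twisting:
  assumes G: "G \<in> amalgams_of_type K C G0"
  obtains c where "twisting c" "realizes G c"
proof -
  note obj = amalgams_of_typeD(2)[OF G] and img = amalgams_of_typeD(3)[OF G]
    and comp = simplicial_amalgamD(3)[OF amalgams_of_typeD(1)[OF G]]
  have emb: "mor G \<sigma> \<tau> \<in> embeddings C (obj G0 \<tau>) (obj G0 \<sigma>)"
    if "\<sigma> \<in> K" "\<tau> \<in> K" "\<sigma> \<subseteq> \<tau>" for \<sigma> \<tau>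
    using simplicial_amalgamD(4)[OF amalgams_of_typeD(1)[OF G] that] obj that by simp
  \<comment> \<open>The implication stands under the existential so that choice yields a total
    \<open>c\<close>, arbitrary off nested simplices.\<close>
  have "\<exists>g. \<sigma> \<in> K \<and> \<tau> \<in> K \<and> \<sigma> \<subseteq> \<tau> \<longrightarrow>
      g \<in> isos C (obj G0 \<tau>) (obj G0 \<tau>) \<and> \<psi> \<sigma> \<tau> \<cdot> g = mor G \<sigma> \<tau>" for \<sigma> \<tau>
  proof (cases "\<sigma> \<in> K \<and> \<tau> \<in> K \<and> \<sigma> \<subseteq> \<tau>")
    case True
    then have K: "\<sigma> \<in> K" "\<tau> \<in> K" "\<sigma> \<subseteq> \<tau>" by auto
    then have "fn C (mor G \<sigma> \<tau>) ` pts C (obj G0 \<tau>) = fn C (\<psi> \<sigma> \<tau>) ` pts C (obj G0 \<tau>)"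
      using img[OF K] obj[OF K(2)] by (simp add: img_def)
    then obtain g where "g \<in> isos C (obj G0 \<tau>) (obj G0 \<tau>)" "\<psi> \<sigma> \<tau> \<cdot> g = mor G \<sigma> \<tau>"
      by (rule embedding_factor_iso[OF mor_embedding[OF K] emb[OF K]])
    then show ?thesis by blast
  qed blast
  then obtain c where c: "\<And>\<sigma> \<tau>. \<sigma> \<in> K \<Longrightarrow> \<tau> \<in> K \<Longrightarrow> \<sigma> \<subseteq> \<tau> \<Longrightarrow> c \<sigma> \<tau> \<in> isos C (obj G0 \<tau>) (obj G0 \<tau>)"
    and \<psi>c: "\<And>\<sigma> \<tau>. \<sigma> \<in> K \<Longrightarrow> \<tau> \<in> K \<Longrightarrow> \<sigma> \<subseteq> \<tau> \<Longrightarrow> \<psi> \<sigma> \<tau> \<cdot> c \<sigma> \<tau> = mor G \<sigma> \<tau>"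
    by metis
  have carr: "c \<sigma> \<tau> \<in> carrier (A \<tau>)" if K: "\<sigma> \<in> K" "\<tau> \<in> K" "\<sigma> \<subseteq> \<tau>" for \<sigma> \<tau>
    unfolding coeff_iff
  proof (intro conjI ballI impI c K)
    fix \<rho> assume \<rho>: "\<rho> \<in> K" "\<tau> \<subseteq> \<rho>"
    have le: "\<sigma> \<subseteq> \<rho>" using K \<rho> by blast
    note ca = isos_arrows[OF c[OF K]] and s = img_subset[OF K(2) \<rho>]
    \<comment> \<open>After the injective \<open>\<psi> \<sigma> \<tau>\<close> the claim concerns
      only \<open>mor G\<close>, whose composites are given by functoriality and whose images agree
      with those of \<open>G0\<close>.\<close>
    have "fn C (\<psi> \<sigma> \<tau>) ` fn C (c \<sigma> \<tau>) ` img C G0 \<tau> \<rho> = fn C (mor G \<sigma> \<tau>) ` img C G0 \<tau> \<rho>"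
      using fn_comp_image[OF mor_arrow[OF K] ca s] \<psi>c[OF K] by simp
    also have "\<dots> = fn C (mor G \<sigma> \<tau>) ` fn C (mor G \<tau> \<rho>) ` pts C (obj G0 \<rho>)"
      using img[OF K(2) \<rho>] obj[OF \<rho>(1)] by (simp add: img_def)
    also have "\<dots> = fn C (mor G \<sigma> \<rho>) ` pts C (obj G0 \<rho>)"
      using fn_comp_image[OF embeddings_arrows[OF emb[OF K]] embeddings_arrows[OF emb[OF K(2) \<rho>]] subset_refl]
        comp[OF K(1,2) \<rho>(1) K(3) \<rho>(2)] by simp
    also have "\<dots> = img C G0 \<sigma> \<rho>"
      using img[OF K(1) \<rho>(1) le] obj[OF \<rho>(1)] by (simp add: img_def)
    finally show "fn C (c \<sigma> \<tau>) ` img C G0 \<tau> \<rho> = img C G0 \<tau> \<rho>"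
      by (intro img_eqI[OF K _ \<rho>] image_subsetI fn_apply_closed[OF ca] subsetD[OF s])
  qed
  have "twisting c"
    unfolding twisting_def coeff_simps
  proof (intro conjI ballI impI carr)
    fix \<rho> \<sigma> \<tau> assume K: "\<rho> \<in> K" "\<sigma> \<in> K" "\<tau> \<in> K" and "\<rho> \<subseteq> \<sigma> \<and> \<sigma> \<subseteq> \<tau>"
    then have le: "\<rho> \<subseteq> \<sigma>" "\<sigma> \<subseteq> \<tau>" "\<rho> \<subseteq> \<tau>" by auto
    note x = carr[OF K(1,2) le(1)] and y = carr[OF K(2,3) le(2)]
    have "\<psi> \<rho> \<tau> \<cdot> c \<rho> \<tau> = \<psi> \<rho> \<tau> \<cdot> (\<alpha> \<sigma> \<tau> (c \<rho> \<sigma>) \<cdot> c \<sigma> \<tau>)"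
      using \<psi>c[OF K(1,3) le(3)] \<psi>c[OF K(1,2) le(1)] \<psi>c[OF K(2,3) le(2)] comp[OF K le(1,2)]
        twisted_comp[OF K le(1,2) x coeff_arrows[OF y]] by simp
    then show "c \<rho> \<tau> = \<alpha> \<sigma> \<tau> (c \<rho> \<sigma>) \<cdot> c \<sigma> \<tau>"
      by (rule embedding_mono[OF mor_embedding[OF K(1,3) le(3)] coeff_arrows[OF carr[OF K(1,3) le(3)]]
          comp_closed[OF coeff_map_arrow(1)[OF K(2,3) le(2) x] coeff_arrows[OF y]]])
  qed auto
  moreover have "realizes G c" using obj \<psi>c by (simp add: realizes_def)
  ultimately show thesis by (rule that)
qed

text \<open>Each connecting morphism of \<open>G0\<close> is preceded by an automorphism of its
  source, so it remains an embedding with the same image; \<open>twisted_comp\<close> and the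
  twisting law give functoriality.\<close>

lemma twisting_realized:
  assumes c: "twisting c"
  obtains G where "G \<in> amalgams_of_type K C G0" "realizes G c"
proof -
  define G where "G = \<lparr>obj = obj G0, mor = \<lambda>\<sigma> \<tau>. \<psi> \<sigma> \<tau> \<cdot> c \<sigma> \<tau>\<rparr>"
  have [simp]: "obj G = obj G0" "mor G \<sigma> \<tau> = \<psi> \<sigma> \<tau> \<cdot> c \<sigma> \<tau>" for \<sigma> \<tau> by (simp_all add: G_def)
  note carr = twisting_closed[OF c]
  have "simplicial_amalgam K C G"
    unfolding simplicial_amalgam_def
  proof (intro conjI ballI impI)
    fix \<sigma> assume \<sigma>: "\<sigma> \<in> K"
    then show "obj G \<sigma> \<in> Ob C" by (simp add: obj_Ob)
    show "mor G \<sigma> \<sigma> = ident C (obj G \<sigma>)"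
      using twisting_same[OF c \<sigma>] ident_left[OF ident_closed[OF obj_Ob[OF \<sigma>]]] \<sigma>
      by (simp add: mor_same coeff_simps)
  next
    fix \<rho> \<sigma> \<tau> assume K: "\<rho> \<in> K" "\<sigma> \<in> K" "\<tau> \<in> K" and "\<rho> \<subseteq> \<sigma> \<and> \<sigma> \<subseteq> \<tau>"
    then have le: "\<rho> \<subseteq> \<sigma>" "\<sigma> \<subseteq> \<tau>" by auto
    show "mor G \<rho> \<sigma> \<cdot> mor G \<sigma> \<tau> = mor G \<rho> \<tau>"
      using twisted_comp[OF K le carr[OF K(1,2) le(1)] coeff_arrows[OF carr[OF K(2,3) le(2)]]]
        twisting_comp[OF c K le] by (simp add: coeff_simps)
  next
    fix \<sigma> \<tau> assume "\<sigma> \<in> K" "\<tau> \<in> K" "\<sigma> \<subseteq> \<tau>"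
    then show "mor G \<sigma> \<tau> \<in> embeddings C (obj G \<tau>) (obj G \<sigma>)"
      by (simp add: embedding_comp[OF mor_embedding iso_is_embedding[OF coeff_isos[OF carr]]])
  qed
  moreover have "img C G \<sigma> \<tau> = img C G0 \<sigma> \<tau>" if K: "\<sigma> \<in> K" "\<tau> \<in> K" "\<sigma> \<subseteq> \<tau>" for \<sigma> \<tau>
    using fn_comp_image[OF mor_arrow[OF K] coeff_arrows[OF carr[OF K]] subset_refl]
      iso_image[OF coeff_isos[OF carr[OF K]]]
    by (simp add: img_def)
  ultimately have "G \<in> amalgams_of_type K C G0" unfolding amalgams_of_type_def by simp
  moreover have "realizes G c" by (simp add: realizes_def)
  ultimately show thesis by (rule that)
qed

text \<open>Cancelling the embedding determines a twisting from its amalgam on nested simplices.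
  These are the only values that enter an edge cochain, which thus depends on the amalgam
  alone.\<close>

lemma realizes_unique:
  assumes "twisting c" "twisting c'" "realizes G c" "realizes G c'"
    and K: "\<sigma> \<in> K" "\<tau> \<in> K" "\<sigma> \<subseteq> \<tau>"
  shows "c \<sigma> \<tau> = c' \<sigma> \<tau>"
  by (rule embedding_mono[OF mor_embedding[OF K] coeff_arrows[OF twisting_closed[OF assms(1) K]]
        coeff_arrows[OF twisting_closed[OF assms(2) K]]])
    (simp only: mor_eq[OF assms(3) K, symmetric] mor_eq[OF assms(4) K, symmetric])

lemma edge_cochain_cong:
  assumes "\<And>\<sigma> \<tau>. \<sigma> \<in> K \<Longrightarrow> \<tau> \<in> K \<Longrightarrow> \<sigma> \<subseteq> \<tau> \<Longrightarrow> c \<sigma> \<tau> = c' \<sigma> \<tau>"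
  shows "edge_cochain c = edge_cochain c'"
  unfolding edge_cochain_def
proof (rule restrict_ext)
  fix \<tau> assume "\<tau> \<in> simplices K 1"
  then show "c {Max \<tau>} \<tau> \<otimes>\<^bsub>A \<tau>\<^esub> inv\<^bsub>A \<tau>\<^esub> c {Min \<tau>} \<tau> = c' {Max \<tau>} \<tau> \<otimes>\<^bsub>A \<tau>\<^esub> inv\<^bsub>A \<tau>\<^esub> c' {Min \<tau>} \<tau>"
    by (rule edge_cases) (simp add: assms)
qed

text \<open>Once \<open>f\<close> is moved across \<open>\<psi> \<sigma> \<tau>\<close>, both
  composites begin with this embedding and it can be cancelled. The naturality square of amalgams
  thereby becomes an equation in the coefficient group.\<close>

lemma natural_iff:
  assumes c: "twisting c" and c': "twisting c'" and K: "\<sigma> \<in> K" "\<tau> \<in> K" "\<sigma> \<subseteq> \<tau>"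
    and f: "f \<in> carrier (A \<sigma>)" and h: "h \<in> arrows C (obj G0 \<tau>) (obj G0 \<tau>)"
  shows "f \<cdot> (\<psi> \<sigma> \<tau> \<cdot> c \<sigma> \<tau>) = \<psi> \<sigma> \<tau> \<cdot> c' \<sigma> \<tau> \<cdot> h \<longleftrightarrow> \<alpha> \<sigma> \<tau> f \<cdot> c \<sigma> \<tau> = c' \<sigma> \<tau> \<cdot> h"
proof -
  note a = mor_arrow[OF K] and ca = coeff_arrows[OF twisting_closed[OF c K]]
    and ca' = coeff_arrows[OF twisting_closed[OF c' K]] and fm = coeff_map_arrow[OF K f]
  have "f \<cdot> (\<psi> \<sigma> \<tau> \<cdot> c \<sigma> \<tau>) = \<psi> \<sigma> \<tau> \<cdot> (\<alpha> \<sigma> \<tau> f \<cdot> c \<sigma> \<tau>)"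
    using comp_assoc[OF coeff_arrows[OF f] a ca] comp_assoc[OF a fm(1) ca] fm(2) by simp
  moreover have "\<psi> \<sigma> \<tau> \<cdot> c' \<sigma> \<tau> \<cdot> h = \<psi> \<sigma> \<tau> \<cdot> (c' \<sigma> \<tau> \<cdot> h)" by (rule comp_assoc[OF a ca' h])
  ultimately show ?thesis
    using embedding_mono[OF mor_embedding[OF K] comp_closed[OF fm(1) ca] comp_closed[OF ca' h]] by auto
qed

text \<open>The squares are translated by \<open>natural_iff\<close>; the remaining point is that
  the components of an isomorphism stabilize the distinguished images.\<close>

lemma isomorphic_iff_twist_equiv:
  assumes G: "G \<in> amalgams_of_type K C G0" and G': "G' \<in> amalgams_of_type K C G0"
    and c: "twisting c" "realizes G c" and c': "twisting c'" "realizes G' c'"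
  shows "amalgam_isomorphic K C G G' \<longleftrightarrow> twist_equiv c c'"
proof -
  have obj: "obj G \<sigma> = obj G0 \<sigma>" "obj G' \<sigma> = obj G0 \<sigma>" if "\<sigma> \<in> K" for \<sigma>
    using c(2) c'(2) that by (simp_all add: realizes_def)
  show ?thesis
  proof
    assume "amalgam_isomorphic K C G G'"
    then obtain \<phi> where iso: "\<And>\<sigma>. \<sigma> \<in> K \<Longrightarrow> \<phi> \<sigma> \<in> isos C (obj G \<sigma>) (obj G' \<sigma>)"
      and nat: "\<And>\<sigma> \<tau>. \<sigma> \<in> K \<Longrightarrow> \<tau> \<in> K \<Longrightarrow> \<sigma> \<subseteq> \<tau> \<Longrightarrow> \<phi> \<sigma> \<cdot> mor G \<sigma> \<tau> = mor G' \<sigma> \<tau> \<cdot> \<phi> \<tau>"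
      unfolding amalgam_isomorphic_def by blast
    have \<phi>: "\<phi> \<sigma> \<in> isos C (obj G0 \<sigma>) (obj G0 \<sigma>)" if "\<sigma> \<in> K" for \<sigma>
      using iso[OF that] obj[OF that] by simp
    have carr: "\<phi> \<sigma> \<in> carrier (A \<sigma>)" if \<sigma>: "\<sigma> \<in> K" for \<sigma>
      unfolding coeff_iff
    proof (intro conjI ballI impI \<phi> \<sigma>)
      fix \<tau> assume \<tau>: "\<tau> \<in> K" "\<sigma> \<subseteq> \<tau>"
      have m: "mor H \<sigma> \<tau> \<in> arrows C (obj G0 \<tau>) (obj G0 \<sigma>)"
          "fn C (mor H \<sigma> \<tau>) ` pts C (obj G0 \<tau>) = img C G0 \<sigma> \<tau>"
        if H: "H \<in> amalgams_of_type K C G0" for H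
      proof -
        note H = amalgams_of_typeD[OF H]
        show "mor H \<sigma> \<tau> \<in> arrows C (obj G0 \<tau>) (obj G0 \<sigma>)"
          using embeddings_arrows[OF simplicial_amalgamD(4)[OF H(1) \<sigma> \<tau>]] H(2) \<sigma> \<tau> by simp
        show "fn C (mor H \<sigma> \<tau>) ` pts C (obj G0 \<tau>) = img C G0 \<sigma> \<tau>"
          using H(3)[OF \<sigma> \<tau>] H(2)[OF \<tau>(1)] by (simp add: img_def)
      qed
      \<comment> \<open>By naturality, and since \<open>\<phi> \<tau>\<close> is onto,
        \<open>\<phi> \<sigma>\<close> carries the image of \<open>mor G \<sigma> \<tau>\<close>
        onto that of \<open>mor G' \<sigma> \<tau>\<close>. Both are
        \<open>img C G0 \<sigma> \<tau>\<close> because the amalgams have the same type.\<close>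
      have "fn C (\<phi> \<sigma>) ` img C G0 \<sigma> \<tau> = fn C (\<phi> \<sigma> \<cdot> mor G \<sigma> \<tau>) ` pts C (obj G0 \<tau>)"
        using fn_comp_image[OF isos_arrows[OF \<phi>[OF \<sigma>]] m(1)[OF G] subset_refl] m(2)[OF G] by simp
      also have "\<dots> = img C G0 \<sigma> \<tau>"
        using fn_comp_image[OF m(1)[OF G'] isos_arrows[OF \<phi>[OF \<tau>(1)]] subset_refl] m(2)[OF G']
          nat[OF \<sigma> \<tau>] iso_image[OF \<phi>[OF \<tau>(1)]] by simp
      finally show "fn C (\<phi> \<sigma>) ` img C G0 \<sigma> \<tau> = img C G0 \<sigma> \<tau>" .
    qed
    have "\<alpha> \<sigma> \<tau> (\<phi> \<sigma>) \<cdot> c \<sigma> \<tau> = c' \<sigma> \<tau> \<cdot> \<phi> \<tau>" if K: "\<sigma> \<in> K" "\<tau> \<in> K" "\<sigma> \<subseteq> \<tau>" for \<sigma> \<tau>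
      using nat[OF K] natural_iff[OF c(1) c'(1) K carr[OF K(1)] isos_arrows[OF \<phi>[OF K(2)]]]
      by (simp add: mor_eq[OF c(2) K] mor_eq[OF c'(2) K])
    then show "twist_equiv c c'"
      unfolding twist_equiv_def coeff_simps using carr by blast
  next
    assume "twist_equiv c c'"
    then obtain \<phi> where carr: "\<And>\<sigma>. \<sigma> \<in> K \<Longrightarrow> \<phi> \<sigma> \<in> carrier (A \<sigma>)"
      and nat: "\<And>\<sigma> \<tau>. \<sigma> \<in> K \<Longrightarrow> \<tau> \<in> K \<Longrightarrow> \<sigma> \<subseteq> \<tau> \<Longrightarrow> \<alpha> \<sigma> \<tau> (\<phi> \<sigma>) \<cdot> c \<sigma> \<tau> = c' \<sigma> \<tau> \<cdot> \<phi> \<tau>"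
      unfolding twist_equiv_def coeff_simps by blast
    have "\<phi> \<sigma> \<cdot> mor G \<sigma> \<tau> = mor G' \<sigma> \<tau> \<cdot> \<phi> \<tau>" if K: "\<sigma> \<in> K" "\<tau> \<in> K" "\<sigma> \<subseteq> \<tau>" for \<sigma> \<tau>
      using nat[OF K] natural_iff[OF c(1) c'(1) K carr[OF K(1)] coeff_arrows[OF carr[OF K(2)]]]
      by (simp add: mor_eq[OF c(2) K] mor_eq[OF c'(2) K])
    moreover have "\<phi> \<sigma> \<in> isos C (obj G \<sigma>) (obj G' \<sigma>)" if "\<sigma> \<in> K" for \<sigma>
      using coeff_isos[OF carr[OF that]] obj[OF that] by simp
    ultimately show "amalgam_isomorphic K C G G'"
      unfolding amalgam_isomorphic_def by blast
  qed
qed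

section \<open>The bijection with the first cohomology set\<close>

theorem iso_classes_bij_H1: "\<exists>f. bij_betw f (iso_classes_of_type K C G0) (H1 K A \<alpha>)"
proof -
  define t where "t G = (SOME c. twisting c \<and> realizes G c)" for G
  define orbit where "orbit b = cochain_act K A \<alpha> b ` cochains K A 0" for b
  let ?T = "amalgams_of_type K C G0"
  have t: "twisting (t G)" "realizes G (t G)" if "G \<in> ?T" for G
  proof -
    have "\<exists>c. twisting c \<and> realizes G c" using amalgam_realizes_twisting[OF that] by blast
    then have "twisting (t G) \<and> realizes G (t G)" unfolding t_def by (rule someI_ex)
    then show "twisting (t G)" "realizes G (t G)" by auto
  qed
  have ran: "(\<lambda>G. edge_cochain (t G)) ` ?T = cocycles1 K A \<alpha>"
  proof
    show "(\<lambda>G. edge_cochain (t G)) ` ?T \<subseteq> cocycles1 K A \<alpha>"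
      using edge_cochain_cocycle t(1) by blast
    show "cocycles1 K A \<alpha> \<subseteq> (\<lambda>G. edge_cochain (t G)) ` ?T"
    proof
      fix b assume "b \<in> cocycles1 K A \<alpha>"
      then obtain c where c: "twisting c" "edge_cochain c = b" by (rule edge_cochain_surj)
      obtain G where G: "G \<in> ?T" "realizes G c" using c(1) by (rule twisting_realized)
      \<comment> \<open>The chosen \<open>t G\<close> may differ from the \<open>c\<close> built
        from \<open>b\<close>, but both realize \<open>G\<close>, so they agree on nested simplices
        and have the same edge cochain.\<close>
      have "edge_cochain (t G) = b"
        unfolding c(2)[symmetric]
        by (rule edge_cochain_cong) (rule realizes_unique[OF t(1)[OF G(1)] c(1) t(2)[OF G(1)] G(2)])
      then show "b \<in> (\<lambda>G. edge_cochain (t G)) ` ?T" using G(1) by blast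
    qed
  qed
  have "amalgam_isomorphic K C G G' \<longleftrightarrow> orbit (edge_cochain (t G)) = orbit (edge_cochain (t G'))"
    if "G \<in> ?T" "G' \<in> ?T" for G G'
    unfolding orbit_def
    using isomorphic_iff_twist_equiv[OF that t[OF that(1)] t[OF that(2)]]
      twist_equiv_iff_orbits_eq[OF t(1)[OF that(1)] t(1)[OF that(2)]] by simp
  \<comment> \<open>The orbit of the edge cochain is a complete invariant: isomorphism is its kernel
    on \<open>?T\<close>, and by \<open>ran\<close> its values are the orbits of all
    cocycles.\<close>
  from bij_betw_quotient_kernel[of ?T "amalgam_isomorphic K C" "\<lambda>G. orbit (edge_cochain (t G))", OF this]
  have "bij_betw (\<lambda>X. the_elem ((\<lambda>G. orbit (edge_cochain (t G))) ` X)) (iso_classes_of_type K C G0)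
      ((\<lambda>G. orbit (edge_cochain (t G))) ` ?T)"
    unfolding iso_classes_of_type_def .
  moreover have "(\<lambda>G. orbit (edge_cochain (t G))) ` ?T = H1 K A \<alpha>"
    unfolding H1_def orbit_def[symmetric] ran[symmetric] by (simp add: image_image)
  ultimately show ?thesis by auto
qed

end

theorem theorem2:
  fixes n :: nat
    and K :: "nat set set"
    and C :: "('o, 'm, 'u) concrete_precategory"
    and G0 :: "('o, 'm) amalgam"
  assumes "simplicial_complex n K"
    and "concrete_category C"
    and "simplicial_amalgam K C G0"
  shows "\<exists>f. bij_betw f (iso_classes_of_type K C G0)
               (H1 K (coeff_group K C G0) (coeff_map C G0))"
proof -
  interpret amalgam_setup C n K G0
    using assms by (simp add: amalgam_setup_def amalgam_setup_axioms_def)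
  show ?thesis by (rule iso_classes_bij_H1)
qed

end
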